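(* For partitions $\mu\subseteq\lambda$ and an indeterminate $y$, \[ \sum_\nu \mathrm{vs}_{\lambda/\nu}(t)\,\mathrm{sk}_{\nu/\mu}(t)\,y^{|\lambda/\nu|}=\sum_\sigma t^{n(\sigma)-\binom{\ell(\sigma)}{2}}\,f^\lambda_{\sigma\mu}(t)\prod_{j=1}^{\ell(\sigma)}(y+t^{j-1}), \] where the left sum is over partitions $\nu$ with $\mu\subseteq\nu\subseteq\lambda$ and the right sum over all partitions $\sigma$. Equivalently, for every $m\ge0$, \[ \sum_{\nu:\ |\lambda/\nu|=m}\mathrm{vs}_{\lambda/\nu}(t)\,\mathrm{sk}_{\nu/\mu}(t)=\sum_\sigma t^{n(\sigma)-\binom m2}\,f^\lambda_{\sigma\mu}(t)\begin{bmatrix}\ell(\sigma)\\ m\end{bmatrix}_{t^{-1}}. \]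
   Context: $P_\lambda=P_\lambda(t)$ are Hall--Littlewood functions in the ring of symmetric functions over $\mathbb{Q}(t)$; $f^\lambda_{\sigma\mu}(t)$ is the coefficient of $P_\lambda$ in $P_\sigma P_\mu$. For a partition $\sigma$, $\ell(\sigma)$ is its number of parts and $n(\sigma)=\sum_i(i-1)\sigma_i$. $\lambda^c$ is the conjugate partition, $m_j(\mu)$ the number of parts of $\mu$ equal to $j$, $|\lambda/\nu|=|\lambda|-|\nu|$, and $\begin{bmatrix} a\\ b\end{bmatrix}_q=\frac{(1-q^a)\cdots(1-q^{a-b+1})}{(1-q^b)\cdots(1-q)}$. $\lambda/\nu$ is a vertical strip if $\lambda_i\le\nu_i+1$ for all $i$; $\mathrm{vs}_{\lambda/\nu}(t)=\prod_{j\ge1}\begin{bmatrix}\lambda^c_j-\lambda^c_{j+1}\\ \lambda^c_j-\nu^c_j\end{bmatrix}_t$ if $\lambda/\nu$ is a vertical strip and $0$ otherwise; $\mathrm{sk}_{\nu/\mu}(t)=t^{\sum_j\binom{\nu^c_j-\mu^c_j}{2}}\prod_{j\ge1}\begin{bmatrix}\nu^c_j-\mu^c_{j+1}\\ m_j(\mu)\end{bmatrix}_t$. *)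

theory Defs
  imports "HOL-Computational_Algebra.Polynomial" "HOL-Computational_Algebra.Fraction_Field"
    "HOL-Combinatorics.Permutations"
begin

type_synonym Qt = "rat poly fract"

definition tt :: Qt where "tt = Fract [:0, 1:] 1"

definition is_partition :: "nat list \<Rightarrow> bool" where
  "is_partition l \<longleftrightarrow> sorted_wrt (\<ge>) l \<and> (\<forall>x\<in>set l. 0 < x)"

definition part :: "nat list \<Rightarrow> nat \<Rightarrow> nat" where
  "part l i = (if i < length l then l ! i else 0)"

definition psize :: "nat list \<Rightarrow> nat" where "psize l = sum_list l"

(* conjugate partition: conjp l j = l^c_j for j >= 1 *)
definition conjp :: "nat list \<Rightarrow> nat \<Rightarrow> nat" where
  "conjp l j = length (filter (\<lambda>x. j \<le> x) l)"

definition mult :: "nat list \<Rightarrow> nat \<Rightarrow> nat" where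
  "mult l j = length (filter (\<lambda>x. x = j) l)"

definition contained :: "nat list \<Rightarrow> nat list \<Rightarrow> bool" where
  "contained m l \<longleftrightarrow> (\<forall>i. part m i \<le> part l i)"

definition nfun :: "nat list \<Rightarrow> nat" where
  "nfun l = (\<Sum>i<length l. i * l ! i)"

definition qbinom :: "nat \<Rightarrow> nat \<Rightarrow> 'a::field \<Rightarrow> 'a" where
  "qbinom a b q = (\<Prod>i<b. (1 - q ^ (a - i)) / (1 - q ^ (i + 1)))"

definition vertical_strip :: "nat list \<Rightarrow> nat list \<Rightarrow> bool" where
  "vertical_strip l n \<longleftrightarrow> (\<forall>i. part l i \<le> part n i + 1)"

definition vs :: "nat list \<Rightarrow> nat list \<Rightarrow> Qt" where
  "vs l n = (if vertical_strip l n then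
      (\<Prod>j\<in>{1..max (part l 0) (part n 0)}.
         qbinom (conjp l j - conjp l (j + 1)) (conjp l j - conjp n j) tt)
    else 0)"

definition sk :: "nat list \<Rightarrow> nat list \<Rightarrow> Qt" where
  "sk n m = tt ^ (\<Sum>j\<in>{1..max (part n 0) (part m 0)}. (conjp n j - conjp m j) choose 2)
      * (\<Prod>j\<in>{1..max (part n 0) (part m 0)}.
           qbinom (conjp n j - conjp m (j + 1)) (mult m j) tt)"

(* Hall--Littlewood P_lambda(x_1,...,x_N; t) in N variables (Macdonald III.2.1),
   evaluated at a point x with pairwise distinct coordinates x 0, ..., x (N-1) *)
definition vm :: "nat \<Rightarrow> Qt" where
  "vm m = (\<Prod>i\<in>{1..m}. (1 - tt ^ i) / (1 - tt))"

definition vfac :: "nat \<Rightarrow> nat list \<Rightarrow> Qt" where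
  "vfac N l = vm (N - length l) * (\<Prod>k\<in>{1..part l 0}. vm (mult l k))"

definition HLP :: "nat \<Rightarrow> nat list \<Rightarrow> (nat \<Rightarrow> Qt) \<Rightarrow> Qt" where
  "HLP N l x = (1 / vfac N l) *
     (\<Sum>w\<in>{w. w permutes {..<N}}.
        (\<Prod>i<N. x (w i) ^ part l i) *
        (\<Prod>(i, j)\<in>{(i, j). i < j \<and> j < N}. (x (w i) - tt * x (w j)) / (x (w i) - x (w j))))"

definition partitions_of :: "nat \<Rightarrow> nat list set" where
  "partitions_of n = {l. is_partition l \<and> psize l = n}"

(* f^lambda_{sigma mu}(t): coefficient of P_lambda in P_sigma P_mu, computed in
   N = |sigma| + |mu| variables (where the P_kappa, kappa |- N, form a basis of the
   degree-N symmetric polynomials); zero if |lambda| <> |sigma| + |mu|. *)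
definition hl_f :: "nat list \<Rightarrow> nat list \<Rightarrow> nat list \<Rightarrow> Qt" where
  "hl_f s m l = (let N = psize s + psize m in
     if psize l = N then
       (THE c. (\<forall>k. c k \<noteq> 0 \<longrightarrow> k \<in> partitions_of N) \<and>
          (\<forall>x. inj_on x {..<N} \<longrightarrow>
             HLP N s x * HLP N m x = (\<Sum>k\<in>partitions_of N. c k * HLP N k x))) l
     else 0)"

end

theory Submission
  imports Defs "HOL-Library.FuncSet"
begin

text \<open>
  Write \<open>e\<^sub>r\<close> and \<open>h\<^sub>r\<close> for the elementary and complete homogeneous symmetric functions. The left-hand
  side is the coefficient of \<open>P\<^sub>l\<close> in \<open>P\<^sub>m \<cdot> (\<Sum>r. h\<^sub>r) \<cdot> (\<Sum>r. e\<^sub>r y\<^sup>r)\<close>, because \<open>vs\<close> and \<open>sk\<close> are the Pieri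
  coefficients for multiplication by \<open>e\<^sub>r\<close> and \<open>h\<^sub>r\<close>. Only the first Pieri rule needs an argument with
  polynomials. In terms of conjugate partitions the sum over \<open>n\<close> is a product of independent sums, one
  for each column. At \<open>y = -1\<close> the q-binomial theorem makes this product vanish unless \<open>l = m\<close>, so the
  matrices of \<open>sk\<close> and of the signed \<open>vs\<close> are inverse to each other and the second Pieri rule follows.
  For \<open>m = []\<close> the same product telescopes to a power of \<open>t\<close> times \<open>\<Prod>(y + t\<^bsup>j-1\<^esup>)\<close>, which expands
  \<open>(\<Sum>r. h\<^sub>r) \<cdot> (\<Sum>r. e\<^sub>r y\<^sup>r)\<close> in Hall--Littlewood functions; multiplying this expansion by
  \<open>P\<^sub>m\<close> and comparing coefficients gives the right-hand side.
\<close>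

section \<open>Partitions and their conjugates\<close>

text \<open>\<open>hl_f\<close> is a description operator over coefficient families, tested at
  points of \<open>Qt\<close> with distinct coordinates in |s| + |m| = |l| variables. So symmetric
  functions occur only through their values at such points, and the structure constants must be
  shown to exist and to be unique. Uniqueness is linear independence. Existence means that products
  of Hall--Littlewood functions stay in their span; the Pieri rule for e_r implies it, because every
  Hall--Littlewood function is a combination of products of the e_r.

  The columns separate because, for a vertical strip l/n, column j of n has at least
  \<open>max (conjp l (Suc j)) (conjp m j)\<close> and at most \<open>conjp l j\<close> boxes: the
  upper bound of column j + 1 never exceeds the lower bound of column j, so no monotonicity
  condition remains. The first Pieri rule has the same shape, a column growing at most to the length
  of its left neighbour. Its Gaussian binomials come from symmetrisation: moving a variable one
  place inside a block in which the other factors are symmetric costs a factor t, and Pascal's rule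
  collects these powers.\<close>

lemma part_Nil [simp]: "part [] i = 0"
  by (simp add: part_def)

lemma conjp_Nil [simp]: "conjp [] j = 0"
  by (simp add: conjp_def)

lemma is_partition_Nil [simp]: "is_partition []"
  by (simp add: is_partition_def)

lemma psize_Nil [simp]: "psize [] = 0"
  by (simp add: psize_def)

text \<open>The Young diagram read by rows and by columns. Rows are counted from 0 and columns from
  1, so one side is strict and j = 0 is excluded.\<close>

lemma less_conjp_iff:
  assumes "is_partition p" "1 \<le> j"
  shows "i < conjp p j \<longleftrightarrow> j \<le> part p i"
  using assms(1)
proof (induction p arbitrary: i)
  case Nil
  then show ?case using assms(2) by simp
next
  case (Cons a p)
  have p: "is_partition p" and le: "\<And>x. x \<in> set p \<Longrightarrow> x \<le> a"
    using Cons.prems by (auto simp: is_partition_def)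
  show ?case
  proof (cases "j \<le> a")
    case True
    then have "conjp (a # p) j = Suc (conjp p j)"
      by (simp add: conjp_def)
    then show ?thesis
      using True Cons.IH[OF p] by (cases i) (auto simp: part_def)
  next
    case False
    have "filter ((\<le>) j) p = []"
      using le False by (fastforce simp: filter_empty_conv)
    then have "conjp (a # p) j = 0"
      using False by (simp add: conjp_def)
    moreover have "part (a # p) i \<le> a"
      using le by (cases i) (auto simp: part_def)
    ultimately show ?thesis using False by simp
  qed
qed

lemma conjp_1: "is_partition p \<Longrightarrow> conjp p 1 = length p"
  by (simp add: is_partition_def conjp_def Suc_le_eq)

lemma conjp_Suc_0: "is_partition p \<Longrightarrow> conjp p (Suc 0) = length p"
  using conjp_1 by simp

lemma conjp_antimono: "i \<le> j \<Longrightarrow> conjp p j \<le> conjp p i"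
  unfolding conjp_def by (induction p) auto

lemma part_le_part_0:
  assumes "is_partition p"
  shows "part p i \<le> part p 0"
proof (cases "part p i")
  case (Suc k)
  then have "i < conjp p (part p i)"
    using less_conjp_iff[OF assms, of "part p i" i] by simp
  then have "0 < conjp p (part p i)"
    by simp
  then show ?thesis
    using less_conjp_iff[OF assms, of "part p i" 0] Suc by simp
qed simp

lemma conjp_eq_0:
  assumes "is_partition p" "part p 0 < j"
  shows "conjp p j = 0"
  using less_conjp_iff[OF assms(1), of j 0] assms(2) by auto

lemma mult_conjp: "mult p j = conjp p j - conjp p (Suc j)"
proof -
  have "conjp p j = mult p j + conjp p (Suc j)"
    unfolding conjp_def mult_def by (induction p) auto
  then show ?thesis by simp
qed

lemma partition_eqI_part:
  assumes p: "is_partition p" and q: "is_partition q" and eq: "\<And>i. part p i = part q i"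
  shows "p = q"
proof (rule nth_equalityI)
  have "i < length p \<longleftrightarrow> i < length q" for i
    using less_conjp_iff[OF p, of 1 i] less_conjp_iff[OF q, of 1 i] conjp_1[OF p] conjp_1[OF q] eq
    by simp
  then show "length p = length q"
    by (metis linorder_neqE_nat less_irrefl)
  then show "p ! i = q ! i" if "i < length p" for i
    using eq[of i] that by (simp add: part_def)
qed

lemma partition_eqI_conjp:
  assumes p: "is_partition p" and q: "is_partition q" and eq: "\<And>j. 1 \<le> j \<Longrightarrow> conjp p j = conjp q j"
  shows "p = q"
proof (rule partition_eqI_part[OF p q])
  fix i
  have "j \<le> part p i \<longleftrightarrow> j \<le> part q i" for j
    using less_conjp_iff[OF p, of j i] less_conjp_iff[OF q, of j i] eq[of j] by (cases "j = 0") auto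
  then show "part p i = part q i"
    by (meson le_antisym order_refl)
qed

lemma contained_iff_conjp:
  assumes p: "is_partition p" and q: "is_partition q"
  shows "contained p q \<longleftrightarrow> (\<forall>j\<ge>1. conjp p j \<le> conjp q j)"
proof safe
  fix j :: nat assume c: "contained p q" and j: "1 \<le> j"
  have "i < conjp q j" if "i < conjp p j" for i
    using that less_conjp_iff[OF p j, of i] less_conjp_iff[OF q j, of i] c
    by (meson contained_def le_trans)
  then show "conjp p j \<le> conjp q j"
    by (meson leI less_irrefl)
next
  assume c: "\<forall>j\<ge>1. conjp p j \<le> conjp q j"
  show "contained p q"
    unfolding contained_def
  proof
    fix i
    show "part p i \<le> part q i"
    proof (cases "part p i")
      case (Suc k)
      then have "i < conjp p (part p i)"
        using less_conjp_iff[OF p, of "part p i" i] by simp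
      also have "\<dots> \<le> conjp q (part p i)"
        using c Suc by simp
      finally show ?thesis
        using less_conjp_iff[OF q, of "part p i" i] Suc by simp
    qed simp
  qed
qed

text \<open>At most one new box per row means that the rows reaching column j + 1 of q already reach
  column j of p. In this form the strip condition bounds each column of p separately.\<close>

lemma vertical_strip_iff_conjp:
  assumes p: "is_partition p" and q: "is_partition q"
  shows "vertical_strip q p \<longleftrightarrow> (\<forall>j\<ge>1. conjp q (Suc j) \<le> conjp p j)"
proof safe
  fix j :: nat assume c: "vertical_strip q p" and j: "1 \<le> j"
  have "i < conjp p j" if "i < conjp q (Suc j)" for i
  proof -
    have "Suc j \<le> part q i"
      using that less_conjp_iff[OF q, of "Suc j" i] by simp
    also have "\<dots> \<le> part p i + 1"
      using c by (simp add: vertical_strip_def)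
    finally show ?thesis
      using less_conjp_iff[OF p j] by simp
  qed
  then show "conjp q (Suc j) \<le> conjp p j"
    by (meson leI less_irrefl)
next
  assume c: "\<forall>j\<ge>1. conjp q (Suc j) \<le> conjp p j"
  show "vertical_strip q p"
    unfolding vertical_strip_def
  proof
    fix i
    show "part q i \<le> part p i + 1"
    proof (cases "part q i \<le> 1")
      case False
      then obtain k where k: "part q i = Suc k" "1 \<le> k"
        by (cases "part q i") auto
      then have "i < conjp q (Suc k)"
        using less_conjp_iff[OF q, of "Suc k" i] by simp
      also have "\<dots> \<le> conjp p k"
        using c k by simp
      finally show ?thesis
        using less_conjp_iff[OF p, of k i] k by simp
    qed simp
  qed
qed

lemma contained_refl [simp]: "contained p p"
  by (simp add: contained_def)

lemma contained_trans: "contained p q \<Longrightarrow> contained q r \<Longrightarrow> contained p r"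
  unfolding contained_def by (meson le_trans)

lemma Nil_contained [simp]: "contained [] p"
  by (simp add: contained_def)

section \<open>Size, containment and finiteness\<close>

lemma psize_sum_conjp:
  assumes "\<forall>x\<in>set p. x \<le> L"
  shows "psize p = (\<Sum>j\<in>{1..L}. conjp p j)"
  using assms
proof (induction p)
  case Nil
  then show ?case by simp
next
  case (Cons a p)
  have "conjp (a # p) j = (if j \<le> a then 1 else 0) + conjp p j" for j
    by (simp add: conjp_def)
  moreover have "(\<Sum>j\<in>{1..L}. if j \<le> a then 1 else 0) = a"
  proof -
    have "{1..L} \<inter> {j. j \<le> a} = {1..a}"
      using Cons.prems by auto
    then show ?thesis
      by (simp add: sum.If_cases)
  qed
  ultimately have "(\<Sum>j\<in>{1..L}. conjp (a # p) j) = a + (\<Sum>j\<in>{1..L}. conjp p j)"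
    by (simp add: sum.distrib)
  then show ?case
    using Cons by (simp add: psize_def)
qed

lemma psize_conjp:
  assumes "is_partition p" "part p 0 \<le> L"
  shows "psize p = (\<Sum>j\<in>{1..L}. conjp p j)"
proof (rule psize_sum_conjp, safe)
  fix x assume "x \<in> set p"
  then obtain i where "i < length p" "x = p ! i"
    by (auto simp: in_set_conv_nth)
  then have "x = part p i"
    by (simp add: part_def)
  then show "x \<le> L"
    using part_le_part_0[OF assms(1)] assms(2) le_trans by blast
qed

lemma contained_psize_le:
  assumes p: "is_partition p" and q: "is_partition q" and c: "contained p q"
  shows "psize p \<le> psize q"
proof -
  have "part p 0 \<le> part q 0"
    using c by (simp add: contained_def)
  then show ?thesis
    using psize_conjp[OF p, of "part q 0"] psize_conjp[OF q, of "part q 0"] c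
      contained_iff_conjp[OF p q] by (auto intro!: sum_mono)
qed

lemma contained_psize_eq:
  assumes p: "is_partition p" and q: "is_partition q" and c: "contained p q"
    and eq: "psize p = psize q"
  shows "p = q"
proof (rule partition_eqI_conjp[OF p q])
  fix j :: nat assume j: "1 \<le> j"
  have le: "part p 0 \<le> part q 0"
    using c by (simp add: contained_def)
  have cc: "conjp p j \<le> conjp q j" if "1 \<le> j" for j
    using that c contained_iff_conjp[OF p q] by simp
  show "conjp p j = conjp q j"
  proof (cases "j \<le> part q 0")
    case True
    show ?thesis
    proof (rule ccontr)
      assume "conjp p j \<noteq> conjp q j"
      then have "(\<Sum>j\<in>{1..part q 0}. conjp p j) < (\<Sum>j\<in>{1..part q 0}. conjp q j)"
        using cc j True by (intro sum_strict_mono_ex1) (auto intro!: bexI[of _ j] simp: le_neq_implies_less)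
      then show False
        using psize_conjp[OF p le] psize_conjp[OF q order_refl] eq by simp
    qed
  next
    case False
    then show ?thesis
      using conjp_eq_0[OF p, of j] conjp_eq_0[OF q, of j] le by simp
  qed
qed

lemma length_le_psize:
  assumes "is_partition p"
  shows "length p \<le> psize p"
proof (cases "part p 0")
  case 0
  then have "length p = 0"
    using less_conjp_iff[OF assms, of 1 0] conjp_1[OF assms] by simp
  then show ?thesis by simp
next
  case (Suc k)
  have "conjp p 1 \<le> (\<Sum>j\<in>{1..part p 0}. conjp p j)"
    using Suc by (intro member_le_sum) auto
  then show ?thesis
    using psize_conjp[OF assms order_refl] conjp_1[OF assms] by simp
qed

lemma part_le_psize: "part p i \<le> psize p"
  by (auto simp: part_def psize_def intro: member_le_sum_list)

lemma finite_partitions_of [simp]: "finite (partitions_of n)"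
proof (rule finite_subset)
  show "partitions_of n \<subseteq> {xs. set xs \<subseteq> {..n} \<and> length xs \<le> n}"
  proof safe
    fix p x assume p: "p \<in> partitions_of n"
    then show "length p \<le> n"
      using length_le_psize by (auto simp: partitions_of_def)
    assume "x \<in> set p"
    then show "x \<le> n"
      using p member_le_sum_list[of x p] by (auto simp: partitions_of_def psize_def)
  qed
  show "finite {xs. set xs \<subseteq> {..n} \<and> length xs \<le> n}"
    by (rule finite_lists_length_le) simp
qed

text \<open>n(p) adds up the row indices of all boxes; grouped by columns, a column of length c
  contributes 0 + 1 + ... + (c - 1).\<close>

lemma nfun_conjp:
  assumes p: "is_partition p" and L: "part p 0 \<le> L"
  shows "nfun p = (\<Sum>j\<in>{1..L}. conjp p j choose 2)"
proof -
  have len: "length p = conjp p 1"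
    using conjp_1[OF p] by simp
  have "nfun p = (\<Sum>i<length p. \<Sum>j\<in>{1..L}. if i < conjp p j then i else 0)"
    unfolding nfun_def
  proof (rule sum.cong[OF refl])
    fix i assume "i \<in> {..<length p}"
    then have i: "part p i = p ! i"
      by (simp add: part_def)
    have "{j\<in>{1..L}. i < conjp p j} = {1..p ! i}"
      using less_conjp_iff[OF p] part_le_part_0[OF p, of i] L i by force
    then have "(\<Sum>j\<in>{1..L}. if i < conjp p j then i else 0) = (\<Sum>j\<in>{1..p ! i}. i)"
      by (simp flip: sum.inter_filter)
    then show "i * p ! i = (\<Sum>j\<in>{1..L}. if i < conjp p j then i else 0)"
      by simp
  qed
  also have "\<dots> = (\<Sum>j\<in>{1..L}. \<Sum>i<length p. if i < conjp p j then i else 0)"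
    by (rule sum.swap)
  also have "\<dots> = (\<Sum>j\<in>{1..L}. conjp p j choose 2)"
  proof (rule sum.cong[OF refl])
    fix j assume "j \<in> {1..L}"
    then have "conjp p j \<le> length p"
      unfolding len by (intro conjp_antimono) simp
    then have "{i\<in>{..<length p}. i < conjp p j} = {..<conjp p j}"
      by auto
    then have "(\<Sum>i<length p. if i < conjp p j then i else 0) = \<Sum>{..<conjp p j}"
      by (simp flip: sum.inter_filter)
    also have "\<dots> = conjp p j choose 2"
      by (simp add: choose_two lessThan_atLeast0 Sum_Ico_nat)
    finally show "(\<Sum>i<length p. if i < conjp p j then i else 0) = conjp p j choose 2" .
  qed
  finally show ?thesis .
qed

text \<open>The condition on the bounds forces every choice of column lengths to be decreasing.\<close>

lemma bij_betw_conjp_PiE: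
  assumes ab: "\<And>j. 1 \<le> j \<Longrightarrow> j < L \<Longrightarrow> b (Suc j) \<le> a j"
  shows "bij_betw (\<lambda>p. restrict (conjp p) {1..L})
      {p. is_partition p \<and> part p 0 \<le> L \<and> (\<forall>j\<in>{1..L}. conjp p j \<in> {a j..b j})}
      (PiE {1..L} (\<lambda>j. {a j..b j}))"
  unfolding bij_betw_def
proof safe
  show "inj_on (\<lambda>p. restrict (conjp p) {1..L})
      {p. is_partition p \<and> part p 0 \<le> L \<and> (\<forall>j\<in>{1..L}. conjp p j \<in> {a j..b j})}"
  proof (rule inj_onI, safe)
    fix p q
    assume p: "is_partition p" "part p 0 \<le> L" and q: "is_partition q" "part q 0 \<le> L"
      and eq: "restrict (conjp p) {1..L} = restrict (conjp q) {1..L}"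
    show "p = q"
    proof (rule partition_eqI_conjp[OF p(1) q(1)])
      fix j :: nat assume "1 \<le> j"
      show "conjp p j = conjp q j"
      proof (cases "j \<le> L")
        case True
        then show ?thesis
          using fun_cong[OF eq, of j] \<open>1 \<le> j\<close> by simp
      next
        case False
        then show ?thesis
          using conjp_eq_0 p q by (metis le_less_trans not_le)
      qed
    qed
  qed
next
  fix c assume c: "c \<in> PiE {1..L} (\<lambda>j. {a j..b j})"
  have c_Suc: "c (Suc j) \<le> c j" if "1 \<le> j" "j < L" for j
  proof -
    have "c (Suc j) \<le> b (Suc j)" "a j \<le> c j"
      using PiE_mem[OF c, of "Suc j"] PiE_mem[OF c, of j] that by auto
    then show ?thesis using ab[OF that] by linarith
  qed
  have anti: "c j \<le> c i" if "i \<le> j" "1 \<le> i" "j \<le> L" for i j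
    using that(1,3)
  proof (induction j rule: dec_induct)
    case (step k)
    then show ?case using le_trans[OF c_Suc[of k]] \<open>1 \<le> i\<close> by simp
  qed simp
  \<comment> \<open>The candidate for row i counts the columns longer than i. They form an initial
    segment because \<open>c\<close> decreases.\<close>
  define r where "r i = card {j\<in>{1..L}. i < c j}" for i
  have r: "j \<le> r i \<longleftrightarrow> i < c j" if j: "1 \<le> j" "j \<le> L" for i j
  proof
    assume "i < c j"
    then have "{1..j} \<subseteq> {j\<in>{1..L}. i < c j}"
      using anti j by (auto intro: less_le_trans)
    then have "card {1..j} \<le> r i"
      unfolding r_def by (intro card_mono) auto
    then show "j \<le> r i" by simp
  next
    assume le: "j \<le> r i"
    show "i < c j"
    proof (rule ccontr)
      assume n: "\<not> i < c j"
      have "k < j" if "1 \<le> k" "k \<le> L" "i < c k" for k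
        using anti[of j k] n that j by (meson le_less_trans not_le)
      then have "{j\<in>{1..L}. i < c j} \<subseteq> {1..<j}"
        by auto
      then have "r i \<le> card {1..<j}"
        unfolding r_def by (intro card_mono) auto
      then show False using le j by simp
    qed
  qed
  have rL: "r i \<le> L" for i
    unfolding r_def by (rule order_trans[OF card_mono[of "{1..L}"]]) auto
  \<comment> \<open>The number of rows is the length of the first column. For L = 0 there is no
    column, and 1 lies outside the domain of \<open>c\<close>.\<close>
  define n where "n = (if L = 0 then 0 else c 1)"
  define p where "p = map r [0..<n]"
  have anti_r: "r j \<le> r i" if "i \<le> j" for i j
    unfolding r_def using that by (intro card_mono) auto
  have r0: "r i > 0 \<longleftrightarrow> i < n" for i
  proof (cases "L = 0")
    case False
    then show ?thesis using r[of 1 i] by (auto simp: n_def)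
  qed (use rL[of i] in \<open>simp add: n_def\<close>)
  have p: "is_partition p"
    unfolding is_partition_def
  proof
    show "sorted_wrt (\<ge>) p"
      unfolding p_def sorted_wrt_map sorted_wrt_iff_nth_less using anti_r by simp
    show "\<forall>x\<in>set p. 0 < x"
      using r0 by (auto simp: p_def)
  qed
  have conj: "conjp p j = c j" if "1 \<le> j" "j \<le> L" for j
  proof -
    have "c j \<le> n"
      using anti[of 1 j] that by (simp add: n_def)
    have "i < conjp p j \<longleftrightarrow> i < c j" for i
      using less_conjp_iff[OF p that(1), of i] r[OF that, of i] \<open>c j \<le> n\<close> that
      by (auto simp: part_def p_def)
    then show ?thesis
      by (metis linorder_neqE_nat less_irrefl)
  qed
  have "part p 0 \<le> L"
    using rL by (simp add: part_def p_def)
  moreover have "c = restrict (conjp p) {1..L}"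
    using conj c by (auto simp: restrict_def PiE_def extensional_def)
  moreover have "conjp p j \<in> {a j..b j}" if "j \<in> {1..L}" for j
    using conj[of j] that PiE_mem[OF c, of j] by auto
  ultimately show "c \<in> (\<lambda>p. restrict (conjp p) {1..L}) `
      {p. is_partition p \<and> part p 0 \<le> L \<and> (\<forall>j\<in>{1..L}. conjp p j \<in> {a j..b j})}"
    using p by blast
qed (auto simp: PiE_def Pi_def)

lemma sum_prod_conjp:
  fixes g :: "nat \<Rightarrow> nat \<Rightarrow> 'a::comm_semiring_1"
  assumes "\<And>j. 1 \<le> j \<Longrightarrow> j < L \<Longrightarrow> b (Suc j) \<le> a j"
  shows "(\<Sum>p | is_partition p \<and> part p 0 \<le> L \<and> (\<forall>j\<in>{1..L}. conjp p j \<in> {a j..b j}).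
      \<Prod>j\<in>{1..L}. g j (conjp p j)) = (\<Prod>j\<in>{1..L}. \<Sum>k\<in>{a j..b j}. g j k)"
proof -
  have "(\<Prod>j\<in>{1..L}. \<Sum>k\<in>{a j..b j}. g j k)
      = (\<Sum>c\<in>PiE {1..L} (\<lambda>j. {a j..b j}). \<Prod>j\<in>{1..L}. g j (c j))"
    by (rule prod_sum_PiE) auto
  also have "\<dots> = (\<Sum>p | is_partition p \<and> part p 0 \<le> L \<and> (\<forall>j\<in>{1..L}. conjp p j \<in> {a j..b j}).
      \<Prod>j\<in>{1..L}. g j (restrict (conjp p) {1..L} j))"
    by (rule sum.reindex_bij_betw[OF bij_betw_conjp_PiE, symmetric]) (use assms in auto)
  also have "\<dots> = (\<Sum>p | is_partition p \<and> part p 0 \<le> L \<and> (\<forall>j\<in>{1..L}. conjp p j \<in> {a j..b j}).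
      \<Prod>j\<in>{1..L}. g j (conjp p j))"
    by (intro sum.cong prod.cong refl) simp
  finally show ?thesis ..
qed

section \<open>Gaussian binomials\<close>

text \<open>Polynomials are ordered by the sign of the leading coefficient, which puts the
  indeterminate above every constant. The nonvanishing facts about powers of \<open>tt\<close> come
  from this, and so does the positivity that ends the proof of linear independence.\<close>

lemma tt_gt_1: "1 < tt"
proof -
  have "(1 :: rat poly) < [:0, 1:]"
    unfolding less_poly_def by (simp add: pos_poly_def one_pCons)
  then show ?thesis
    by (simp add: tt_def one_less_Fract_iff)
qed

lemma tt_pos: "0 < tt"
  using tt_gt_1 by (rule less_trans[OF zero_less_one])

lemma tt_nonzero [simp]: "tt \<noteq> 0"
  using tt_pos by simp

lemma tt_power_neq_1 [simp]: "0 < n \<Longrightarrow> tt ^ n \<noteq> 1" "0 < n \<Longrightarrow> 1 \<noteq> tt ^ n"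
  using one_less_power[OF tt_gt_1, of n] by auto

lemma tt_neq_1 [simp]: "tt \<noteq> 1" "1 \<noteq> tt"
  using tt_gt_1 by auto

lemma one_minus_tt_power_neq_0 [simp]: "0 < n \<Longrightarrow> 1 - tt ^ n \<noteq> 0"
  by (metis right_minus_eq tt_power_neq_1(2))

lemma vm_0 [simp]: "vm 0 = 1"
  by (simp add: vm_def)

lemma vm_Suc: "vm (Suc n) = vm n * ((1 - tt ^ Suc n) / (1 - tt))"
  by (simp add: vm_def)

lemma vm_nonzero [simp]: "vm n \<noteq> 0"
  by (induction n) (auto simp: vm_Suc simp del: power_Suc)

lemma qbinom_0 [simp]: "qbinom a 0 q = 1"
  by (simp add: qbinom_def)

lemma qbinom_Suc: "qbinom a (Suc b) q = qbinom a b q * ((1 - q ^ (a - b)) / (1 - q ^ Suc b))"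
  by (simp add: qbinom_def)

lemma qbinom_eq_0: "a < b \<Longrightarrow> qbinom a b q = 0"
  unfolding qbinom_def by (rule prod_zero) (auto intro!: bexI[of _ a])

text \<open>\<open>vm\<close> is the t-factorial. In this form later identities between Gaussian
  binomials become cancellations of factorials.\<close>

lemma qbinom_vm:
  assumes "b \<le> a"
  shows "qbinom a b tt = vm a / (vm b * vm (a - b))"
  using assms
proof (induction b)
  case (Suc b)
  then have "a - b = Suc (a - Suc b)" by simp
  then have "vm (a - b) = vm (a - Suc b) * ((1 - tt ^ (a - b)) / (1 - tt))"
    using vm_Suc by metis
  moreover have "v / (w * (u * (A / C))) * (A / B) = v / ((w * (B / C)) * u)"
    if "A \<noteq> 0" "B \<noteq> 0" "C \<noteq> 0" for A B C u v w :: Qt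
    using that by (simp add: divide_simps)
  moreover have "1 - tt ^ (a - b) \<noteq> 0" "1 - tt ^ Suc b \<noteq> 0" "1 - tt \<noteq> 0"
    using Suc.prems by (simp_all del: power_Suc)
  ultimately show ?case
    using Suc by (simp add: qbinom_Suc vm_Suc del: power_Suc)
qed simp

lemma qbinom_self [simp]: "qbinom a a tt = 1"
  by (simp add: qbinom_vm)

lemma qbinom_symmetric: "b \<le> a \<Longrightarrow> qbinom a (a - b) tt = qbinom a b tt"
  by (simp add: qbinom_vm mult.commute)

text \<open>From 1 - t^(k+1) = (1 - t^(k-r)) + t^(k-r) (1 - t^(r+1)). Of the two Pascal rules this
  is the one whose power k - r also counts the places by which a variable moves in
  \<open>HL_sym_block\<close>.\<close>

lemma qbinom_Pascal:
  assumes "r \<le> k"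
  shows "qbinom (Suc k) (Suc r) tt = qbinom k (Suc r) tt + tt ^ (k - r) * qbinom k r tt"
proof -
  have r: "1 - tt ^ Suc r \<noteq> 0" by (rule one_minus_tt_power_neq_0) simp
  have k: "qbinom (Suc k) (Suc r) tt = qbinom k r tt * ((1 - tt ^ Suc k) / (1 - tt ^ Suc r))"
  proof -
    have "(v * (A / C)) / (w * (B / C) * u) = v / (w * u) * (A / B)"
      if "C \<noteq> 0" for A B C u v w :: Qt
      using that by (simp add: divide_simps)
    then show ?thesis
      using assms by (simp add: qbinom_vm vm_Suc del: power_Suc)
  qed
  have "tt ^ Suc k = tt ^ (k - r) * tt ^ Suc r"
    using assms by (simp flip: power_add del: power_Suc)
  then have "1 - tt ^ Suc k = (1 - tt ^ (k - r)) + tt ^ (k - r) * (1 - tt ^ Suc r)"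
    by (simp add: algebra_simps del: power_Suc)
  then have "(1 - tt ^ Suc k) / (1 - tt ^ Suc r) = (1 - tt ^ (k - r)) / (1 - tt ^ Suc r) + tt ^ (k - r)"
    using r by (simp only: add_divide_distrib) simp
  then show ?thesis
    unfolding k using qbinom_Suc[of k r tt] by (simp add: algebra_simps del: power_Suc)
qed

text \<open>Pascal's rule multiplies in the factor y + t^(b+n). The offset b lets the product start
  at t^b, as needed to join the products of consecutive columns in \<open>skew_poly_Nil\<close>; the
  vanishing at y = -1 uses b = 0.\<close>

lemma q_binomial_theorem:
  fixes y :: "Qt poly"
  shows "(\<Sum>i\<le>n. [:qbinom n i tt * tt ^ (b * i + (i choose 2)):] * y ^ (n - i)) = (\<Prod>i<n. y + [:tt ^ (b + i):])"
proof (induction n)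
  case (Suc n)
  let ?f = "\<lambda>n i. [:qbinom n i tt * tt ^ (b * i + (i choose 2)):] * y ^ (n - i)"
  have ex: "(b * Suc i + (Suc i choose 2)) + (n - i) = (b * i + (i choose 2)) + (b + n)" if "i \<le> n" for i
    using that by (simp add: numeral_2_eq_2)
  have eq: "?f (Suc n) (Suc i) = ?f n (Suc i) * y + ?f n i * [:tt ^ (b + n):]" if "i \<le> n" for i
  proof -
    have "?f (Suc n) (Suc i) = [:qbinom n (Suc i) tt * tt ^ (b * Suc i + (Suc i choose 2)):] * y ^ (n - i)
      + [:qbinom n i tt * (tt ^ (b * Suc i + (Suc i choose 2)) * tt ^ (n - i)):] * y ^ (n - i)"
      using that by (simp add: qbinom_Pascal algebra_simps smult_add_left del: power_Suc)
    also have "[:qbinom n (Suc i) tt * tt ^ (b * Suc i + (Suc i choose 2)):] * y ^ (n - i) = ?f n (Suc i) * y"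
    proof (cases "i = n")
      case False
      then have "n - i = Suc (n - Suc i)" using that by simp
      then show ?thesis by (simp add: mult.commute)
    qed (simp add: qbinom_eq_0)
    also have "tt ^ (b * Suc i + (Suc i choose 2)) * tt ^ (n - i) = tt ^ (b * i + (i choose 2)) * tt ^ (b + n)"
      unfolding power_add[symmetric] ex[OF that] ..
    finally show ?thesis
      by (simp add: algebra_simps)
  qed
  have "(\<Sum>i\<le>Suc n. ?f (Suc n) i) = y ^ Suc n + (\<Sum>i\<le>n. ?f (Suc n) (Suc i))"
    by (subst sum.atMost_Suc_shift) (simp add: numeral_2_eq_2)
  also have "(\<Sum>i\<le>n. ?f (Suc n) (Suc i)) = (\<Sum>i\<le>n. ?f n (Suc i)) * y + (\<Sum>i\<le>n. ?f n i) * [:tt ^ (b + n):]"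
    unfolding sum_distrib_right sum.distrib[symmetric] by (intro sum.cong refl eq) simp
  also have "y ^ Suc n + ((\<Sum>i\<le>n. ?f n (Suc i)) * y + (\<Sum>i\<le>n. ?f n i) * [:tt ^ (b + n):])
      = (y ^ n + (\<Sum>i\<le>n. ?f n (Suc i))) * y + (\<Sum>i\<le>n. ?f n i) * [:tt ^ (b + n):]"
    by (simp add: algebra_simps)
  also have "y ^ n + (\<Sum>i\<le>n. ?f n (Suc i)) = (\<Sum>i\<le>Suc n. ?f n i)"
    by (subst sum.atMost_Suc_shift) (simp add: numeral_2_eq_2)
  also have "\<dots> = (\<Sum>i\<le>n. ?f n i)"
    by (simp add: qbinom_eq_0)
  finally show ?case
    using Suc by (simp add: algebra_simps)
qed (simp add: numeral_2_eq_2)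

section \<open>Sums over vertical strips\<close>

text \<open>The product may run over any range that covers the columns of l, as empty columns
  contribute \<open>qbinom 0 0\<close>, which is 1. This gives \<open>vs\<close> and
  \<open>sk\<close> a common range.\<close>

lemma vs_conjp:
  assumes l: "is_partition l" and n: "is_partition n" and c: "contained n l"
    and v: "vertical_strip l n" and L: "part l 0 \<le> L"
  shows "vs l n = (\<Prod>j\<in>{1..L}. qbinom (conjp l j - conjp l (Suc j)) (conjp l j - conjp n j) tt)"
proof -
  have "max (part l 0) (part n 0) = part l 0"
    using c by (auto simp: contained_def max_def intro: le_antisym)
  then have "vs l n = (\<Prod>j\<in>{1..part l 0}. qbinom (conjp l j - conjp l (Suc j)) (conjp l j - conjp n j) tt)"
    using v by (simp add: vs_def)
  also have "\<dots> = (\<Prod>j\<in>{1..L}. qbinom (conjp l j - conjp l (Suc j)) (conjp l j - conjp n j) tt)"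
    using L by (intro prod.mono_neutral_left) (auto simp: conjp_eq_0[OF l])
  finally show ?thesis .
qed

lemma sk_conjp:
  assumes n: "is_partition n" and m: "is_partition m" and c: "contained m n" and L: "part n 0 \<le> L"
  shows "sk n m = (\<Prod>j\<in>{1..L}. tt ^ (conjp n j - conjp m j choose 2)
    * qbinom (conjp n j - conjp m (Suc j)) (conjp m j - conjp m (Suc j)) tt)"
proof -
  have le: "part m 0 \<le> part n 0"
    using c by (simp add: contained_def)
  then have "sk n m = (\<Prod>j\<in>{1..part n 0}. tt ^ (conjp n j - conjp m j choose 2)
    * qbinom (conjp n j - conjp m (Suc j)) (conjp m j - conjp m (Suc j)) tt)"
    by (simp add: sk_def max_def mult_conjp power_sum prod.distrib)
  also have "\<dots> = (\<Prod>j\<in>{1..L}. tt ^ (conjp n j - conjp m j choose 2)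
    * qbinom (conjp n j - conjp m (Suc j)) (conjp m j - conjp m (Suc j)) tt)"
    using L le by (intro prod.mono_neutral_left)
      (auto simp: conjp_eq_0[OF n] conjp_eq_0[OF m] numeral_2_eq_2)
  finally show ?thesis .
qed

lemma smult_sum_right: "smult c (\<Sum>i\<in>S. f i) = (\<Sum>i\<in>S. smult c (f i))"
  by (induction S rule: infinite_finite_induct) (auto simp: smult_add_right)

text \<open>The left-hand side of the theorem as a polynomial in y = \<open>[:0, 1:]\<close>. The
  proof also uses it at m = [] and evaluates it at y = -1.\<close>

definition skew_poly :: "nat list \<Rightarrow> nat list \<Rightarrow> Qt poly" where
  "skew_poly l m = (\<Sum>n | is_partition n \<and> contained m n \<and> contained n l.
     smult (vs l n * sk n m) ([:0, 1:] ^ (psize l - psize n)))"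

lemma finite_contained:
  assumes l: "is_partition l"
  shows "finite {n. is_partition n \<and> contained n l \<and> P n}"
proof (rule finite_subset)
  show "{n. is_partition n \<and> contained n l \<and> P n} \<subseteq> (\<Union>k\<le>psize l. partitions_of k)"
    using contained_psize_le[OF _ l] by (auto simp: partitions_of_def)
qed simp

text \<open>Terms for which l/n is not a vertical strip vanish. For the others both the weight and
  the admissible range split by columns: the strip condition and m bound column j from below, l
  bounds it from above, and these bounds satisfy the hypothesis of
  \<open>sum_prod_conjp\<close>.\<close>

lemma skew_poly_factor:
  assumes l: "is_partition l" and m: "is_partition m" and c: "contained m l"
  shows "skew_poly l m = (\<Prod>j\<in>{1..part l 0}. \<Sum>k\<in>{max (conjp l (Suc j)) (conjp m j)..conjp l j}.
    smult (qbinom (conjp l j - conjp l (Suc j)) (conjp l j - k) tt * (tt ^ (k - conjp m j choose 2)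
      * qbinom (k - conjp m (Suc j)) (conjp m j - conjp m (Suc j)) tt)) ([:0, 1:] ^ (conjp l j - k)))"
    (is "_ = (\<Prod>j\<in>_. \<Sum>k\<in>_. ?g j k)")
proof -
  define L where "L = part l 0"
  let ?S = "{n. is_partition n \<and> part n 0 \<le> L \<and>
    (\<forall>j\<in>{1..L}. conjp n j \<in> {max (conjp l (Suc j)) (conjp m j)..conjp l j})}"
  have S: "?S = {n. is_partition n \<and> contained m n \<and> contained n l \<and> vertical_strip l n}"
  proof safe
    fix n assume n: "is_partition n" and nL: "part n 0 \<le> L"
      and j: "\<forall>j\<in>{1..L}. conjp n j \<in> {max (conjp l (Suc j)) (conjp m j)..conjp l j}"
    have *: "conjp n j \<in> {max (conjp l (Suc j)) (conjp m j)..conjp l j}" if "1 \<le> j" for j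
    proof (cases "j \<le> L")
      case False
      then have "conjp n j = 0" "conjp l j = 0" "conjp m j = 0" "conjp l (Suc j) = 0"
        using n m l nL c by (auto simp: L_def contained_def intro!: conjp_eq_0 dest: spec[of _ 0])
      then show ?thesis by simp
    qed (use j that in auto)
    show "contained m n" "contained n l" "vertical_strip l n"
      using * by (auto simp: contained_iff_conjp[OF m n] contained_iff_conjp[OF n l]
          vertical_strip_iff_conjp[OF n l])
  next
    fix n j assume "is_partition n" "contained m n" "contained n l" "vertical_strip l n" "j \<in> {1..L}"
    then show "conjp n j \<in> {max (conjp l (Suc j)) (conjp m j)..conjp l j}"
      using contained_iff_conjp[OF m, of n] contained_iff_conjp[OF _ l, of n]
        vertical_strip_iff_conjp[OF _ l, of n] by auto
  qed (auto simp: L_def contained_def)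
  have "skew_poly l m = (\<Sum>n\<in>?S. smult (vs l n * sk n m) ([:0, 1:] ^ (psize l - psize n)))"
    unfolding skew_poly_def S
  proof (rule sum.mono_neutral_right)
    have "finite {n. is_partition n \<and> contained n l \<and> contained m n}"
      by (rule finite_contained[OF l])
    then show "finite {n. is_partition n \<and> contained m n \<and> contained n l}"
      by (rule rev_finite_subset) auto
  qed (auto simp: vs_def)
  also have "\<dots> = (\<Sum>n\<in>?S. \<Prod>j\<in>{1..L}. ?g j (conjp n j))"
  proof (rule sum.cong[OF refl])
    fix n assume nS: "n \<in> ?S"
    then have n: "is_partition n" and mn: "contained m n" and nl: "contained n l" and v: "vertical_strip l n"
      unfolding S by auto
    have nL: "part n 0 \<le> L" using nS by auto
    have "psize l - psize n = (\<Sum>j\<in>{1..L}. conjp l j - conjp n j)"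
      using psize_conjp[OF l, of L] psize_conjp[OF n nL] contained_iff_conjp[OF n l] nl
      by (subst sum_subtractf_nat) (auto simp: L_def)
    then show "smult (vs l n * sk n m) ([:0, 1:] ^ (psize l - psize n)) = (\<Prod>j\<in>{1..L}. ?g j (conjp n j))"
      unfolding prod_smult
      by (simp add: vs_conjp[OF l n nl v, of L] sk_conjp[OF n m mn nL] L_def prod.distrib power_sum)
  qed
  also have "\<dots> = (\<Prod>j\<in>{1..L}. \<Sum>k\<in>{max (conjp l (Suc j)) (conjp m j)..conjp l j}. ?g j k)"
    by (rule sum_prod_conjp) auto
  finally show ?thesis unfolding L_def .
qed

text \<open>For m = l the range of every column shrinks to one length, and its weight is 1.\<close>

lemma skew_poly_refl:
  assumes l: "is_partition l"
  shows "skew_poly l l = 1"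
proof -
  have "max (conjp l (Suc j)) (conjp l j) = conjp l j" for j
    using conjp_antimono[of j "Suc j" l] by simp
  then show ?thesis
    by (simp add: skew_poly_factor[OF l l] numeral_2_eq_2 flip: one_pCons)
qed

text \<open>One factor of the column product vanishes, that of the last column j in which m and l
  differ. Since they agree in column j + 1, the sum over k collapses by the q-binomial theorem to a
  multiple of the product of y + t^i for i < \<open>conjp l j - conjp m j\<close>, which is nonempty
  and so contains y + 1.\<close>

lemma poly_skew_poly_minus_1:
  assumes l: "is_partition l" and m: "is_partition m" and c: "contained m l" and ne: "m \<noteq> l"
  shows "poly (skew_poly l m) (- 1) = 0"
proof -
  define J where "J = {j. 1 \<le> j \<and> conjp m j < conjp l j}"
  have le: "conjp m j \<le> conjp l j" if "1 \<le> j" for j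
    using c contained_iff_conjp[OF m l] that by simp
  have "J \<noteq> {}"
  proof
    assume "J = {}"
    then have "conjp m j = conjp l j" if "1 \<le> j" for j
      using le[OF that] that by (auto simp: J_def le_less)
    then show False
      using partition_eqI_conjp[OF m l] ne by blast
  qed
  moreover have J: "J \<subseteq> {1..part l 0}"
  proof
    fix j assume "j \<in> J"
    then show "j \<in> {1..part l 0}"
      using conjp_eq_0[OF l, of j] by (cases "j \<le> part l 0") (auto simp: J_def)
  qed
  moreover have "finite J"
    using J finite_subset by blast
  ultimately have "Max J \<in> J" and Max: "\<And>i. i \<in> J \<Longrightarrow> i \<le> Max J"
    by auto
  define j where "j = Max J"
  define a b d where "a = conjp l j" and "b = conjp l (Suc j)" and "d = conjp m j"
  have j: "1 \<le> j" "d < a" "j \<in> {1..part l 0}"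
    using \<open>Max J \<in> J\<close> J by (auto simp: J_def j_def a_def d_def)
  have "Suc j \<notin> J"
    using Max[of "Suc j"] unfolding j_def by auto
  then have m_Suc: "conjp m (Suc j) = b"
    using le[of "Suc j"] by (auto simp: J_def b_def)
  have bd: "b \<le> d"
    using conjp_antimono[of j "Suc j" m] m_Suc by (simp add: d_def)
  \<comment> \<open>The q-analogue of trinomial revision: both sides are the quotient of
    \<open>vm (a - b)\<close> by the factorials of d - b, i and a - d - i. It applies because
    \<open>conjp m (Suc j)\<close> is b as well.\<close>
  have q: "qbinom (a - b) (a - (d + i)) tt * qbinom (d + i - b) (d - b) tt
      = qbinom (a - b) (d - b) tt * qbinom (a - d) i tt" if "i \<le> a - d" for i
  proof -
    have "a - b - (a - (d + i)) = d + i - b" "d + i - b - (d - b) = i" "a - b - (d - b) = a - d"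
      using that bd j by auto
    then have "qbinom (a - b) (a - (d + i)) tt = vm (a - b) / (vm (a - (d + i)) * vm (d + i - b))"
      "qbinom (d + i - b) (d - b) tt = vm (d + i - b) / (vm (d - b) * vm i)"
      "qbinom (a - b) (d - b) tt = vm (a - b) / (vm (d - b) * vm (a - d))"
      using that bd j by (subst qbinom_vm; simp)+
    moreover have "qbinom (a - d) i tt = vm (a - d) / (vm i * vm (a - (d + i)))"
      using that by (simp add: qbinom_vm)
    ultimately show ?thesis
      by simp
  qed
  have "(\<Sum>k\<in>{max b d..a}. smult (qbinom (a - b) (a - k) tt * (tt ^ (k - d choose 2)
      * qbinom (k - b) (d - b) tt)) ([:0, 1:] ^ (a - k)))
    = (\<Sum>i\<le>a - d. smult (qbinom (a - b) (a - (d + i)) tt * (tt ^ (i choose 2)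
      * qbinom (d + i - b) (d - b) tt)) ([:0, 1:] ^ (a - (d + i))))"
    using bd j by (intro sum.reindex_bij_witness[of _ "\<lambda>i. d + i" "\<lambda>k. k - d"]) auto
  also have "\<dots> = (\<Sum>i\<le>a - d. smult (qbinom (a - b) (d - b) tt)
      ([:qbinom (a - d) i tt * tt ^ (0 * i + (i choose 2)):] * [:0, 1:] ^ (a - d - i)))"
    proof (rule sum.cong[OF refl])
    fix i assume "i \<in> {..a - d}"
    then have e: "qbinom (a - b) (a - (d + i)) tt * (tt ^ (i choose 2) * qbinom (d + i - b) (d - b) tt)
      = qbinom (a - b) (d - b) tt * (qbinom (a - d) i tt * tt ^ (i choose 2))"
      using arg_cong[OF q[of i], of "\<lambda>u. u * tt ^ (i choose 2)"] by (simp add: mult.assoc mult.commute[of "qbinom (d + i - b) (d - b) tt"])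
    show "smult (qbinom (a - b) (a - (d + i)) tt * (tt ^ (i choose 2)
        * qbinom (d + i - b) (d - b) tt)) ([:0, 1:] ^ (a - (d + i)))
      = smult (qbinom (a - b) (d - b) tt)
      ([:qbinom (a - d) i tt * tt ^ (0 * i + (i choose 2)):] * [:0, 1:] ^ (a - d - i))"
      by (simp add: e)
  qed
  also have "\<dots> = smult (qbinom (a - b) (d - b) tt) (\<Prod>i<a - d. [:0, 1:] + [:tt ^ i:])"
    unfolding smult_sum_right[symmetric] q_binomial_theorem by simp
  finally have sum_eq: "(\<Sum>k\<in>{max b d..a}. smult (qbinom (a - b) (a - k) tt * (tt ^ (k - d choose 2)
      * qbinom (k - b) (d - b) tt)) ([:0, 1:] ^ (a - k)))
    = smult (qbinom (a - b) (d - b) tt) (\<Prod>i<a - d. [:0, 1:] + [:tt ^ i:])" .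
  have "(\<Prod>i<a - d. poly ([:0, 1:] + [:tt ^ i:]) (- 1)) = 0"
    using j by (intro prod_zero) (auto intro!: bexI[of _ 0])
  then show ?thesis
    unfolding skew_poly_factor[OF l m c] poly_prod
    using j by (intro prod_zero bexI[of _ j])
      (auto simp: m_Suc sum_eq poly_prod a_def[symmetric] b_def[symmetric] d_def[symmetric] simp del: poly_sum)
qed

text \<open>Column j gives t to the power \<open>conjp l (Suc j) choose 2\<close> times the factors
  y + t^i for i from \<open>conjp l (Suc j)\<close> to \<open>conjp l j - 1\<close>. These intervals
  tile 0, ..., \<open>length l - 1\<close>. The exponents of t add up to n(l) without the term of
  the first column, which explains the subtraction of \<open>length l choose 2\<close>.\<close>

lemma skew_poly_Nil:
  assumes l: "is_partition l"
  shows "skew_poly l [] = smult (tt powi (int (nfun l) - int (length l choose 2)))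
    (\<Prod>j\<in>{1..length l}. [:tt ^ (j - 1), 1:])"
proof -
  define L where "L = part l 0"
  have F: "(\<Sum>k\<in>{max (conjp l (Suc j)) (conjp [] j)..conjp l j}.
    smult (qbinom (conjp l j - conjp l (Suc j)) (conjp l j - k) tt * (tt ^ (k - conjp [] j choose 2)
      * qbinom (k - conjp [] (Suc j)) (conjp [] j - conjp [] (Suc j)) tt)) ([:0, 1:] ^ (conjp l j - k)))
    = smult (tt ^ (conjp l (Suc j) choose 2)) (\<Prod>i\<in>{conjp l (Suc j)..<conjp l j}. [:tt ^ i, 1:])" for j
  proof -
    define a b where "a = conjp l j" and "b = conjp l (Suc j)"
    have ba: "b \<le> a" unfolding a_def b_def by (rule conjp_antimono) simp
    \<comment> \<open>Splits \<open>k choose 2\<close> at k = b + i and thereby produces the offset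
      b of the q-binomial theorem.\<close>
    have ch: "(b + i) choose 2 = (b choose 2) + (b * i + (i choose 2))" for i
      by (induction i) (auto simp: numeral_2_eq_2)
    have "(\<Sum>k\<in>{b..a}. smult (qbinom (a - b) (a - k) tt * tt ^ (k choose 2)) ([:0, 1:] ^ (a - k)))
      = (\<Sum>i\<le>a - b. smult (qbinom (a - b) (a - (b + i)) tt * tt ^ ((b + i) choose 2)) ([:0, 1:] ^ (a - (b + i))))"
      using ba by (intro sum.reindex_bij_witness[of _ "\<lambda>i. b + i" "\<lambda>k. k - b"]) auto
    also have "\<dots> = (\<Sum>i\<le>a - b. smult (tt ^ (b choose 2))
        ([:qbinom (a - b) i tt * tt ^ (b * i + (i choose 2)):] * [:0, 1:] ^ (a - b - i)))"
    proof (rule sum.cong[OF refl])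
      fix i assume "i \<in> {..a - b}"
      then have "qbinom (a - b) (a - (b + i)) tt = qbinom (a - b) i tt"
        using qbinom_symmetric[of i "a - b"] by simp
      then show "smult (qbinom (a - b) (a - (b + i)) tt * tt ^ ((b + i) choose 2)) ([:0, 1:] ^ (a - (b + i)))
        = smult (tt ^ (b choose 2)) ([:qbinom (a - b) i tt * tt ^ (b * i + (i choose 2)):] * [:0, 1:] ^ (a - b - i))"
        by (simp add: ch power_add mult.left_commute)
    qed
    also have "\<dots> = smult (tt ^ (b choose 2)) (\<Prod>i<a - b. [:tt ^ (b + i), 1:])"
      unfolding smult_sum_right[symmetric] q_binomial_theorem by simp
    also have "(\<Prod>i<a - b. [:tt ^ (b + i), 1:]) = (\<Prod>i\<in>{b..<a}. [:tt ^ i, 1:])"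
      using ba by (intro prod.reindex_bij_witness[of _ "\<lambda>i. i - b" "\<lambda>i. b + i"]) auto
    finally show ?thesis
      by (simp add: a_def b_def)
  qed
  have tele: "(\<Prod>j\<in>{1..K}. \<Prod>i\<in>{conjp l (Suc j)..<conjp l j}. [:tt ^ i, 1:])
      = (\<Prod>i\<in>{conjp l (Suc K)..<conjp l 1}. [:tt ^ i, 1:])" for K
  proof (induction K)
    case (Suc K)
    have "{conjp l (Suc (Suc K))..<conjp l 1} = {conjp l (Suc K)..<conjp l 1}
        \<union> {conjp l (Suc (Suc K))..<conjp l (Suc K)}"
      using conjp_antimono[of 1 "Suc K" l] conjp_antimono[of "Suc K" "Suc (Suc K)" l] by auto
    then show ?case
      using Suc by (simp add: prod.union_disjoint)
  qed simp
  have "conjp l (Suc L) = 0"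
    using conjp_eq_0[OF l] by (simp add: L_def)
  moreover have "(\<Prod>i\<in>{0..<length l}. [:tt ^ i, 1:]) = (\<Prod>j\<in>{1..length l}. [:tt ^ (j - 1), 1:])"
    by (intro prod.reindex_bij_witness[of _ "\<lambda>j. j - 1" Suc]) auto
  ultimately have prod: "(\<Prod>j\<in>{1..L}. \<Prod>i\<in>{conjp l (Suc j)..<conjp l j}. [:tt ^ i, 1:])
      = (\<Prod>j\<in>{1..length l}. [:tt ^ (j - 1), 1:])"
    using tele[of L] conjp_1[OF l] by simp
  \<comment> \<open>One empty column is added, so that dropping the first column leaves exactly the
    shifted sum up to L.\<close>
  have "nfun l = (\<Sum>j\<in>{1..Suc L}. conjp l j choose 2)"
    by (rule nfun_conjp[OF l]) (simp add: L_def)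
  also have "\<dots> = (conjp l 1 choose 2) + (\<Sum>j\<in>{Suc 1..Suc L}. conjp l j choose 2)"
    by (rule sum.atLeast_Suc_atMost) simp
  also have "(\<Sum>j\<in>{Suc 1..Suc L}. conjp l j choose 2) = (\<Sum>j\<in>{1..L}. conjp l (Suc j) choose 2)"
    by (rule sum.shift_bounds_cl_Suc_ivl)
  finally have "int (nfun l) - int (length l choose 2) = int (\<Sum>j\<in>{1..L}. conjp l (Suc j) choose 2)"
    using conjp_1[OF l] by simp
  then have pw: "tt powi (int (nfun l) - int (length l choose 2)) = (\<Prod>j\<in>{1..L}. tt ^ (conjp l (Suc j) choose 2))"
    by (simp only: power_int_of_nat power_sum)
  show ?thesis
    unfolding skew_poly_factor[OF l is_partition_Nil Nil_contained] F L_def[symmetric] prod_smult prod pw ..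
qed

section \<open>Hall--Littlewood symmetrisation\<close>

definition HL_kernel :: "nat \<Rightarrow> (nat \<Rightarrow> Qt) \<Rightarrow> Qt" where
  "HL_kernel N x = (\<Prod>(i, j)\<in>{(i, j). i < j \<and> j < N}. (x i - tt * x j) / (x i - x j))"

text \<open>The values are polynomials in the indeterminate \<open>y\<close> of the theorem.\<close>

definition HL_sym :: "nat \<Rightarrow> ((nat \<Rightarrow> Qt) \<Rightarrow> Qt poly) \<Rightarrow> (nat \<Rightarrow> Qt) \<Rightarrow> Qt poly" where
  "HL_sym N f x = (\<Sum>w | w permutes {..<N}. f (x \<circ> w) * [:HL_kernel N (x \<circ> w):])"

text \<open>The share of a column of length k in the monomial of a partition. The expansion lets
  columns grow one at a time, so the monomial is split this way.\<close>

definition col_prod :: "nat \<Rightarrow> (nat \<Rightarrow> Qt) \<Rightarrow> Qt poly" where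
  "col_prod k x = (\<Prod>i<k. [:x i:])"

definition E_poly :: "nat \<Rightarrow> (nat \<Rightarrow> Qt) \<Rightarrow> Qt poly" where
  "E_poly N x = (\<Prod>i<N. [:1, x i:])"

abbreviation swap_inv :: "((nat \<Rightarrow> Qt) \<Rightarrow> 'b) \<Rightarrow> nat \<Rightarrow> bool" where
  "swap_inv f i \<equiv> (\<forall>x. f (x \<circ> transpose i (Suc i)) = f x)"

section \<open>Linearity of the symmetrisation and exchange of neighbouring variables\<close>

lemma finite_less_pairs [simp]: "finite {(i, j). i < j \<and> j < (N::nat)}"
  by (rule finite_subset[of _ "{..<N} \<times> {..<N}"]) auto

lemma HL_sym_cong: "(\<And>x. f x = g x) \<Longrightarrow> HL_sym N f x = HL_sym N g x"
  by (simp add: HL_sym_def)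

lemma HL_sym_add: "HL_sym N (\<lambda>x. f x + g x) x = HL_sym N f x + HL_sym N g x"
  by (simp add: HL_sym_def smult_add_right sum.distrib)

lemma HL_sym_diff: "HL_sym N (\<lambda>x. f x - g x) x = HL_sym N f x - HL_sym N g x"
  by (simp add: HL_sym_def smult_diff_right sum_subtractf)

lemma HL_sym_mult_const: "HL_sym N (\<lambda>x. c * f x) x = c * HL_sym N f x"
  by (simp add: HL_sym_def sum_distrib_left mult.assoc)

text \<open>Exchanging two neighbours permutes the pairs other than (i, i + 1) without reversing any
  of them. The equation is cross-multiplied because x_i - t x_(i+1) may be 0 even if the coordinates
  are distinct.\<close>

lemma HL_kernel_swap:
  assumes i: "Suc i < N" and ne: "x i \<noteq> x (Suc i)"
  shows "HL_kernel N (x \<circ> transpose i (Suc i)) * (x i - tt * x (Suc i))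
    = - (HL_kernel N x * (x (Suc i) - tt * x i))"
proof -
  define R where "R = {(a, b). a < b \<and> b < N} - {(i, Suc i)}"
  let ?s = "transpose i (Suc i)"
  let ?g = "\<lambda>x (a, b). (x a - tt * x b) / (x a - x b :: Qt)"
  have split: "HL_kernel N z = ?g z (i, Suc i) * prod (?g z) R" for z
    unfolding HL_kernel_def R_def
    using i by (intro prod.remove) auto
  have inv: "prod (?g (x \<circ> ?s)) R = prod (?g x) R"
    by (rule prod.reindex_bij_witness[of _ "\<lambda>(a, b). (?s a, ?s b)" "\<lambda>(a, b). (?s a, ?s b)"])
      (use i in \<open>auto simp: R_def transpose_def split: if_splits\<close>)
  define p where "p = prod (?g x) R"
  show ?thesis
    unfolding split inv p_def[symmetric] using ne by (simp add: field_simps)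
qed

text \<open>The added factor makes each summand antisymmetric in the positions i and i + 1, so the
  sum equals its own negative.\<close>

lemma HL_sym_antisymmetric:
  assumes i: "Suc i < N" and inj: "inj_on x {..<N}" and f: "swap_inv f i"
  shows "HL_sym N (\<lambda>x. f x * [:x (Suc i) - tt * x i:]) x = 0"
proof -
  let ?s = "transpose i (Suc i)"
  let ?F = "\<lambda>x. f x * [:x (Suc i) - tt * x i:] * [:HL_kernel N x:]"
  have s: "?s permutes {..<N}"
    using i by (intro permutes_swap_id) auto
  have "(\<Sum>w | w permutes {..<N}. ?F (x \<circ> w)) = (\<Sum>w | w permutes {..<N}. ?F (x \<circ> (w \<circ> ?s)))"
    by (rule sum.reindex_bij_witness[of _ "\<lambda>w. w \<circ> ?s" "\<lambda>w. w \<circ> ?s"])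
      (use s in \<open>auto simp: o_assoc[symmetric] intro: permutes_compose\<close>)
  also have "\<dots> = (\<Sum>w | w permutes {..<N}. - ?F (x \<circ> w))"
  proof (rule sum.cong[OF refl], safe)
    fix w assume w: "w permutes {..<N}"
    let ?z = "x \<circ> w"
    have "w i \<noteq> w (Suc i)" "w i < N" "w (Suc i) < N"
      using w i permutes_in_image[OF w] permutes_inj[OF w] by (auto dest: injD)
    then have "?z i \<noteq> ?z (Suc i)"
      using inj by (auto dest: inj_onD)
    then have "HL_kernel N (?z \<circ> ?s) * (?z i - tt * ?z (Suc i)) = - (HL_kernel N ?z * (?z (Suc i) - tt * ?z i))"
      by (rule HL_kernel_swap[OF i])
    then have "[:(?z \<circ> ?s) (Suc i) - tt * (?z \<circ> ?s) i:] * [:HL_kernel N (?z \<circ> ?s):]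
        = - ([:?z (Suc i) - tt * ?z i:] * [:HL_kernel N ?z:])"
      by (simp add: mult.commute)
    moreover have "f (?z \<circ> ?s) = f ?z"
      using f by blast
    ultimately have "?F (?z \<circ> ?s) = - ?F ?z"
      by (simp only: mult.assoc mult_minus_right)
    then show "?F (x \<circ> (w \<circ> ?s)) = - ?F (x \<circ> w)"
      by (simp only: o_assoc)
  qed
  finally show ?thesis
    by (simp add: HL_sym_def sum_negf)
qed

text \<open>Beside a factor symmetric in the positions i and i + 1, the symmetrisation treats
  x_(i+1) as t x_i. The powers of t in the Pieri rule originate here.\<close>

lemma HL_sym_swap:
  assumes "Suc i < N" "inj_on x {..<N}" "swap_inv f i"
  shows "HL_sym N (\<lambda>x. f x * [:x (Suc i):]) x = [:tt:] * HL_sym N (\<lambda>x. f x * [:x i:]) x"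
proof -
  have "HL_sym N (\<lambda>x. f x * [:x (Suc i):]) x - [:tt:] * HL_sym N (\<lambda>x. f x * [:x i:]) x
      = HL_sym N (\<lambda>x. f x * [:x (Suc i):] - [:tt:] * (f x * [:x i:])) x"
    unfolding HL_sym_diff HL_sym_mult_const ..
  also have "\<dots> = HL_sym N (\<lambda>x. f x * [:x (Suc i) - tt * x i:]) x"
    by (rule HL_sym_cong) (simp add: smult_diff_left mult.commute)
  finally show ?thesis
    using HL_sym_antisymmetric[OF assms] by simp
qed

lemma HL_sym_move:
  assumes "p \<le> q" "q < N" "inj_on x {..<N}" "\<And>i. p \<le> i \<Longrightarrow> i < q \<Longrightarrow> swap_inv f i"
  shows "HL_sym N (\<lambda>x. f x * [:x q:]) x = [:tt ^ (q - p):] * HL_sym N (\<lambda>x. f x * [:x p:]) x"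
  using assms
proof (induction q rule: dec_induct)
  case (step q)
  have "HL_sym N (\<lambda>x. f x * [:x (Suc q):]) x = [:tt:] * HL_sym N (\<lambda>x. f x * [:x q:]) x"
    using step.hyps by (intro HL_sym_swap step.prems) auto
  moreover have "HL_sym N (\<lambda>x. f x * [:x q:]) x = [:tt ^ (q - p):] * HL_sym N (\<lambda>x. f x * [:x p:]) x"
    using step.prems(1) by (intro step.IH step.prems) auto
  ultimately show ?case
    using step.hyps by (simp add: Suc_diff_le)
qed (simp flip: one_pCons)

lemma swap_inv_prod:
  fixes g :: "Qt \<Rightarrow> 'b::comm_monoid_mult"
  assumes "i \<in> A \<longleftrightarrow> Suc i \<in> A"
  shows "swap_inv (\<lambda>x. \<Prod>k\<in>A. g (x k)) i"
proof
  fix x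
  show "(\<Prod>k\<in>A. g ((x \<circ> transpose i (Suc i)) k)) = (\<Prod>k\<in>A. g (x k))"
    by (rule prod.reindex_bij_witness[of _ "transpose i (Suc i)" "transpose i (Suc i)"])
      (use assms in \<open>auto simp: transpose_def split: if_splits\<close>)
qed

lemma swap_inv_mult: "swap_inv f i \<Longrightarrow> swap_inv g i \<Longrightarrow> swap_inv (\<lambda>x. f x * (g x :: 'b :: times)) i"
  by simp

lemma swap_inv_at: "i \<noteq> k \<Longrightarrow> Suc i \<noteq> k \<Longrightarrow> swap_inv (\<lambda>x. g (x k)) i"
  by (simp add: transpose_def)

text \<open>Symmetrisation turns e_r of a block into a Gaussian binomial times the leading monomial.
  Induction splits off the last factor 1 + y x_(a+k): in its second term the variable moves down to
  position a + r at the cost of t^(k-r), and Pascal's rule combines the two terms. The factor is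
  absorbed into \<open>f\<close>, which therefore varies in the induction.\<close>

lemma HL_sym_block:
  assumes "a + k \<le> N" "inj_on x {..<N}" "\<And>i. a \<le> i \<Longrightarrow> Suc i < a + k \<Longrightarrow> swap_inv f i"
  shows "HL_sym N (\<lambda>x. f x * (\<Prod>i\<in>{a..<a + k}. [:1, x i:])) x
    = (\<Sum>r\<le>k. [:qbinom k r tt:] * [:0, 1:] ^ r * HL_sym N (\<lambda>x. f x * (\<Prod>i\<in>{a..<a + r}. [:x i:])) x)"
  using assms
proof (induction k arbitrary: f)
  case (Suc k)
  define H where "H r = HL_sym N (\<lambda>x. f x * (\<Prod>i\<in>{a..<a + r}. [:x i:])) x" for r
  let ?Y = "[:0, 1:] :: Qt poly"
  have move: "HL_sym N (\<lambda>x. f x * [:1, x (a + k):] * (\<Prod>i\<in>{a..<a + r}. [:x i:])) x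
      = H r + ?Y * [:tt ^ (k - r):] * H (Suc r)" if "r \<le> k" for r
  proof -
    let ?g = "\<lambda>x. f x * (\<Prod>i\<in>{a..<a + r}. [:x i:])"
    have "HL_sym N (\<lambda>x. ?g x * [:x (a + k):]) x = [:tt ^ (a + k - (a + r)):] * HL_sym N (\<lambda>x. ?g x * [:x (a + r):]) x"
      using that Suc.prems(1) by (intro HL_sym_move swap_inv_mult swap_inv_prod Suc.prems(2,3)) auto
    moreover have "HL_sym N (\<lambda>x. ?g x * [:x (a + r):]) x = H (Suc r)"
      unfolding H_def by (rule HL_sym_cong) (simp add: mult_ac)
    moreover have "HL_sym N (\<lambda>x. f x * [:1, x (a + k):] * (\<Prod>i\<in>{a..<a + r}. [:x i:])) x
        = HL_sym N (\<lambda>x. ?g x + ?Y * (?g x * [:x (a + k):])) x"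
    proof (rule HL_sym_cong)
      fix x
      have "[:1, x (a + k):] = 1 + ?Y * [:x (a + k):]"
        by (simp add: one_pCons)
      then show "f x * [:1, x (a + k):] * (\<Prod>i\<in>{a..<a + r}. [:x i:]) = ?g x + ?Y * (?g x * [:x (a + k):])"
        by (simp only: ring_distribs mult_1_right mult_ac)
    qed
    ultimately show ?thesis
      unfolding HL_sym_add HL_sym_mult_const H_def by (simp add: mult.assoc)
  qed
  have "HL_sym N (\<lambda>x. f x * (\<Prod>i\<in>{a..<a + Suc k}. [:1, x i:])) x
      = HL_sym N (\<lambda>x. f x * [:1, x (a + k):] * (\<Prod>i\<in>{a..<a + k}. [:1, x i:])) x"
    by (rule HL_sym_cong) (simp only: prod.atLeastLessThan_Suc add_Suc_right le_add1 mult_ac)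
  also have "\<dots> = (\<Sum>r\<le>k. [:qbinom k r tt:] * ?Y ^ r
      * HL_sym N (\<lambda>x. f x * [:1, x (a + k):] * (\<Prod>i\<in>{a..<a + r}. [:x i:])) x)"
    using Suc.prems(1) by (intro Suc.IH swap_inv_mult swap_inv_at Suc.prems(2,3)) auto
  also have "\<dots> = (\<Sum>r\<le>k. [:qbinom k r tt:] * ?Y ^ r * (H r + ?Y * [:tt ^ (k - r):] * H (Suc r)))"
    by (intro sum.cong refl arg_cong2[of _ _ _ _ "(*)"] move) simp
  also have "\<dots> = (\<Sum>r\<le>k. [:qbinom k r tt:] * ?Y ^ r * H r)
      + (\<Sum>r\<le>k. [:tt ^ (k - r) * qbinom k r tt:] * ?Y ^ Suc r * H (Suc r))"
    unfolding sum.distrib[symmetric] by (intro sum.cong refl) (simp add: algebra_simps)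
  also have "(\<Sum>r\<le>k. [:qbinom k r tt:] * ?Y ^ r * H r) = (\<Sum>r\<le>Suc k. [:qbinom k r tt:] * ?Y ^ r * H r)"
    by (simp add: qbinom_eq_0)
  also have "\<dots> = H 0 + (\<Sum>r\<le>k. [:qbinom k (Suc r) tt:] * ?Y ^ Suc r * H (Suc r))"
    by (subst sum.atMost_Suc_shift) (simp flip: one_pCons)
  also have "H 0 + (\<Sum>r\<le>k. [:qbinom k (Suc r) tt:] * ?Y ^ Suc r * H (Suc r))
      + (\<Sum>r\<le>k. [:tt ^ (k - r) * qbinom k r tt:] * ?Y ^ Suc r * H (Suc r))
      = H 0 + (\<Sum>r\<le>k. [:qbinom (Suc k) (Suc r) tt:] * ?Y ^ Suc r * H (Suc r))"
    unfolding add.assoc sum.distrib[symmetric]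
    by (intro arg_cong2[of _ _ _ _ "(+)"] sum.cong refl) (simp add: qbinom_Pascal smult_add_left algebra_simps del: power_Suc)
  also have "\<dots> = (\<Sum>r\<le>Suc k. [:qbinom (Suc k) r tt:] * ?Y ^ r * H r)"
    by (subst sum.atMost_Suc_shift) (simp flip: one_pCons)
  finally show ?case unfolding H_def .
qed (simp flip: one_pCons)

section \<open>The Pieri rule\<close>

lemma sum_PiE_Suc:
  "(\<Sum>d\<in>PiE {1..Suc K} B. f d) = (\<Sum>d\<in>PiE {1..K} B. \<Sum>e\<in>B (Suc K). f (d(Suc K := e)))"
proof -
  have "{1..Suc K} = insert (Suc K) {1..K}"
    by auto
  then have "(\<Sum>d\<in>PiE {1..Suc K} B. f d) = (\<Sum>(d, e)\<in>PiE {1..K} B \<times> B (Suc K). f (d(Suc K := e)))"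
    by (intro sum.reindex_bij_witness[of _ "\<lambda>(d, e). d(Suc K := e)"
          "\<lambda>d. (d(Suc K := undefined), d (Suc K))"])
      (auto simp: PiE_def extensional_def)
  then show ?thesis
    by (simp add: sum.cartesian_product)
qed

lemma col_prod_extend: "col_prod c x * (\<Prod>i\<in>{c..<c + r}. [:x i:]) = col_prod (c + r) x"
proof -
  have "{..<c + r} = {..<c} \<union> {c..<c + r}"
    by auto
  then show ?thesis
    by (simp add: col_prod_def prod.union_disjoint[symmetric] ivl_disj_int)
qed

lemma swap_inv_col_prod: "i \<noteq> k - 1 \<or> k = 0 \<Longrightarrow> swap_inv (col_prod k) i"
  unfolding col_prod_def by (rule swap_inv_prod) auto

lemma swap_inv_prod_family:
  "(\<And>j. j \<in> A \<Longrightarrow> swap_inv (f j) i) \<Longrightarrow> swap_inv (\<lambda>x. \<Prod>j\<in>A. (f j x :: 'b::comm_monoid_mult)) i"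
  by (auto intro: prod.cong)

text \<open>The columns are processed from the left: the symmetry of the factor \<open>F\<close> in the remaining
  blocks of variables is what lets the block expansion be applied to one column after the other.\<close>

lemma HL_sym_columns:
  fixes c :: "nat \<Rightarrow> nat"
  assumes c0: "c 0 = N" and dec: "\<And>j. c (Suc j) \<le> c j" and inj: "inj_on x {..<N}"
    and F: "\<And>i j. j \<in> {1..K} \<Longrightarrow> c j \<le> i \<Longrightarrow> Suc i < c (j - 1) \<Longrightarrow> swap_inv F i"
  shows "HL_sym N (\<lambda>x. F x * (\<Prod>j\<in>{1..K}. col_prod (c j) x) * (\<Prod>i\<in>{c K..<N}. [:1, x i:])) x
    = (\<Sum>d\<in>PiE {1..K} (\<lambda>j. {c j..c (j - 1)}).
        (\<Prod>j\<in>{1..K}. [:qbinom (c (j - 1) - c j) (d j - c j) tt:] * [:0, 1:] ^ (d j - c j))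
        * HL_sym N (\<lambda>x. F x * (\<Prod>j\<in>{1..K}. col_prod (d j) x)) x)"
  using F
proof (induction K arbitrary: F)
  case 0
  then show ?case by (simp add: c0)
next
  case (Suc K)
  let ?B = "\<lambda>j. {c j..c (j - 1)}"
  let ?q = "\<lambda>j k. [:qbinom (c (j - 1) - c j) (k - c j) tt:] * [:0, 1:] ^ (k - c j)"
  have anti: "c j \<le> c i" if "i \<le> j" for i j
    using that by (rule lift_Suc_antimono_le[of c, OF dec])
  define a k where "a = c (Suc K)" and "k = c K - c (Suc K)"
  have ak: "a + k = c K" "a + k \<le> N"
    using dec[of K] anti[of 0 K] c0 by (auto simp: a_def k_def)
  \<comment> \<open>Column K + 1 and its block of variables join the factor, so that the induction
    hypothesis can deal with the columns to the left. The new factor is symmetric in their blocks,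
    which lie beyond position a + k = \<open>c K\<close>.\<close>
  let ?F = "\<lambda>x. F x * col_prod a x * (\<Prod>i\<in>{a..<a + k}. [:1, x i:])"
  have "HL_sym N (\<lambda>x. F x * (\<Prod>j\<in>{1..Suc K}. col_prod (c j) x) * (\<Prod>i\<in>{c (Suc K)..<N}. [:1, x i:])) x
    = HL_sym N (\<lambda>x. ?F x * (\<Prod>j\<in>{1..K}. col_prod (c j) x) * (\<Prod>i\<in>{c K..<N}. [:1, x i:])) x"
  proof (rule HL_sym_cong)
    fix x :: "nat \<Rightarrow> Qt"
    have "{c (Suc K)..<N} = {a..<a + k} \<union> {c K..<N}"
      using ak by (auto simp: a_def)
    then have "(\<Prod>i\<in>{c (Suc K)..<N}. [:1, x i:]) = (\<Prod>i\<in>{a..<a + k}. [:1, x i:]) * (\<Prod>i\<in>{c K..<N}. [:1, x i:])"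
      using ak by (simp add: prod.union_disjoint ivl_disj_int)
    then show "F x * (\<Prod>j\<in>{1..Suc K}. col_prod (c j) x) * (\<Prod>i\<in>{c (Suc K)..<N}. [:1, x i:])
      = ?F x * (\<Prod>j\<in>{1..K}. col_prod (c j) x) * (\<Prod>i\<in>{c K..<N}. [:1, x i:])"
      by (simp add: a_def mult_ac)
  qed
  also have "\<dots> = (\<Sum>d\<in>PiE {1..K} ?B. (\<Prod>j\<in>{1..K}. ?q j (d j))
        * HL_sym N (\<lambda>x. ?F x * (\<Prod>j\<in>{1..K}. col_prod (d j) x)) x)"
  proof (rule Suc.IH)
    fix i j assume j: "j \<in> {1..K}" "c j \<le> i" "Suc i < c (j - 1)"
    then have "a + k \<le> i"
      using anti[of j K] ak by simp
    moreover have "swap_inv F i"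
      using j by (intro Suc.prems[of j]) auto
    ultimately show "swap_inv ?F i"
      by (intro swap_inv_mult swap_inv_prod swap_inv_col_prod) auto
  qed
  also have "\<dots> = (\<Sum>d\<in>PiE {1..K} ?B. \<Sum>e\<in>?B (Suc K). (\<Prod>j\<in>{1..Suc K}. ?q j ((d(Suc K := e)) j))
        * HL_sym N (\<lambda>x. F x * (\<Prod>j\<in>{1..Suc K}. col_prod ((d(Suc K := e)) j) x)) x)"
  proof (rule sum.cong[OF refl])
    fix d assume d: "d \<in> PiE {1..K} ?B"
    \<comment> \<open>The columns already enlarged still cover the block from a to a + k, so they
      are symmetric in it.\<close>
    have dge: "a + k \<le> d j" if "j \<in> {1..K}" for j
      using PiE_mem[OF d that] anti[of j K] that ak by auto
    let ?G = "\<lambda>x. F x * col_prod a x * (\<Prod>j\<in>{1..K}. col_prod (d j) x)"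
    have "HL_sym N (\<lambda>x. ?F x * (\<Prod>j\<in>{1..K}. col_prod (d j) x)) x
        = HL_sym N (\<lambda>x. ?G x * (\<Prod>i\<in>{a..<a + k}. [:1, x i:])) x"
      by (rule HL_sym_cong) (simp only: mult_ac)
    also have "\<dots> = (\<Sum>r\<le>k. [:qbinom k r tt:] * [:0, 1:] ^ r * HL_sym N (\<lambda>x. ?G x * (\<Prod>i\<in>{a..<a + r}. [:x i:])) x)"
    proof (rule HL_sym_block[OF ak(2) inj])
      fix i assume i: "a \<le> i" "Suc i < a + k"
      have Fi: "swap_inv F i"
        using i ak by (intro Suc.prems[of "Suc K"]) (auto simp: a_def)
      have di: "swap_inv (col_prod (d j)) i" if "j \<in> {1..K}" for j
        using dge[OF that] i by (intro swap_inv_col_prod) auto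
      show "swap_inv ?G i"
        by (intro swap_inv_mult swap_inv_prod_family di Fi swap_inv_col_prod) (use i in auto)
    qed
    also have "\<dots> = (\<Sum>r\<le>k. [:qbinom k r tt:] * [:0, 1:] ^ r
        * HL_sym N (\<lambda>x. F x * ((\<Prod>j\<in>{1..K}. col_prod (d j) x) * col_prod (a + r) x)) x)"
    proof -
      have "HL_sym N (\<lambda>x. ?G x * (\<Prod>i\<in>{a..<a + r}. [:x i:])) x
        = HL_sym N (\<lambda>x. F x * ((\<Prod>j\<in>{1..K}. col_prod (d j) x) * col_prod (a + r) x)) x" for r
        by (rule HL_sym_cong) (simp only: col_prod_extend[symmetric] mult_ac)
      then show ?thesis
        by (simp only:)
    qed
    also have "\<dots> = (\<Sum>e\<in>?B (Suc K). ?q (Suc K) e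
        * HL_sym N (\<lambda>x. F x * ((\<Prod>j\<in>{1..K}. col_prod (d j) x) * col_prod e x)) x)"
      using ak by (intro sum.reindex_bij_witness[of _ "\<lambda>e. e - a" "\<lambda>r. a + r"]) (auto simp: a_def k_def)
    finally have "(\<Prod>j\<in>{1..K}. ?q j (d j)) * HL_sym N (\<lambda>x. ?F x * (\<Prod>j\<in>{1..K}. col_prod (d j) x)) x
      = (\<Sum>e\<in>?B (Suc K). (\<Prod>j\<in>{1..K}. ?q j (d j)) * ?q (Suc K) e
        * HL_sym N (\<lambda>x. F x * ((\<Prod>j\<in>{1..K}. col_prod (d j) x) * col_prod e x)) x)"
      by (simp only: sum_distrib_left mult.assoc)
    also have "\<dots> = (\<Sum>e\<in>?B (Suc K). (\<Prod>j\<in>{1..Suc K}. ?q j ((d(Suc K := e)) j))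
        * HL_sym N (\<lambda>x. F x * (\<Prod>j\<in>{1..Suc K}. col_prod ((d(Suc K := e)) j) x)) x)"
    proof (rule sum.cong[OF refl])
      fix e
      have "(\<Prod>j\<in>{1..Suc K}. h j ((d(Suc K := e)) j)) = (\<Prod>j\<in>{1..K}. h j (d j)) * h (Suc K) e" for h :: "nat \<Rightarrow> nat \<Rightarrow> Qt poly"
        by (simp add: mult.commute)
      from this[of ?q] this[of "\<lambda>_ k. col_prod k _"]
      show "(\<Prod>j\<in>{1..K}. ?q j (d j)) * ?q (Suc K) e
        * HL_sym N (\<lambda>x. F x * ((\<Prod>j\<in>{1..K}. col_prod (d j) x) * col_prod e x)) x
        = (\<Prod>j\<in>{1..Suc K}. ?q j ((d(Suc K := e)) j))
        * HL_sym N (\<lambda>x. F x * (\<Prod>j\<in>{1..Suc K}. col_prod ((d(Suc K := e)) j) x)) x"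
        by (simp only:)
    qed
    finally show "(\<Prod>j\<in>{1..K}. ?q j (d j)) * HL_sym N (\<lambda>x. ?F x * (\<Prod>j\<in>{1..K}. col_prod (d j) x)) x
      = (\<Sum>e\<in>?B (Suc K). (\<Prod>j\<in>{1..Suc K}. ?q j ((d(Suc K := e)) j))
        * HL_sym N (\<lambda>x. F x * (\<Prod>j\<in>{1..Suc K}. col_prod ((d(Suc K := e)) j) x)) x)" .
  qed
  also have "\<dots> = (\<Sum>d\<in>PiE {1..Suc K} ?B. (\<Prod>j\<in>{1..Suc K}. ?q j (d j))
        * HL_sym N (\<lambda>x. F x * (\<Prod>j\<in>{1..Suc K}. col_prod (d j) x)) x)"
    by (rule sum_PiE_Suc[symmetric])
  finally show ?case .
qed

section \<open>Normalising factors and monomials in terms of columns\<close>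

lemma vfac_conjp:
  assumes l: "is_partition l" and L: "part l 0 \<le> L"
  shows "vfac N l = vm (N - conjp l 1) * (\<Prod>k\<in>{1..L}. vm (conjp l k - conjp l (Suc k)))"
proof -
  have "(\<Prod>k\<in>{1..part l 0}. vm (mult l k)) = (\<Prod>k\<in>{1..L}. vm (mult l k))"
    using L by (intro prod.mono_neutral_left) (auto simp: mult_conjp conjp_eq_0[OF l])
  then show ?thesis
    by (simp add: vfac_def mult_conjp conjp_1[OF l] del: One_nat_def)
qed

lemma vfac_nonzero [simp]: "vfac N l \<noteq> 0"
  by (simp add: vfac_def)

lemma col_prod_conjp:
  assumes l: "is_partition l" and len: "length l \<le> N" and L: "part l 0 \<le> L"
  shows "(\<Prod>j\<in>{1..L}. col_prod (conjp l j) x) = [:\<Prod>i<N. x i ^ part l i:]"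
proof -
  have "col_prod (conjp l j) x = (\<Prod>i<N. if j \<le> part l i then [:x i:] else 1)" if j: "j \<in> {1..L}" for j
  proof -
    have "conjp l j \<le> N"
      using conjp_antimono[of 1 j l] conjp_1[OF l] len j by simp
    then have "{..<conjp l j} = {i\<in>{..<N}. j \<le> part l i}"
      using less_conjp_iff[OF l, of j] j by force
    then show ?thesis
      unfolding col_prod_def by (simp only: prod.inter_filter finite_lessThan)
  qed
  then have "(\<Prod>j\<in>{1..L}. col_prod (conjp l j) x) = (\<Prod>j\<in>{1..L}. \<Prod>i<N. if j \<le> part l i then [:x i:] else 1)"
    by simp
  also have "\<dots> = (\<Prod>i<N. \<Prod>j\<in>{1..L}. if j \<le> part l i then [:x i:] else 1)"
    by (rule prod.swap)
  also have "\<dots> = (\<Prod>i<N. [:x i ^ part l i:])"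
  proof (rule prod.cong[OF refl])
    fix i
    have "part l i \<le> L"
      using part_le_part_0[OF l] L le_trans by blast
    then have "{j\<in>{1..L}. j \<le> part l i} = {1..part l i}"
      by auto
    then have "(\<Prod>j\<in>{1..L}. if j \<le> part l i then [:x i:] else 1) = [:x i:] ^ part l i"
      by (simp flip: prod.inter_filter)
    then show "(\<Prod>j\<in>{1..L}. if j \<le> part l i then [:x i:] else 1) = [:x i ^ part l i:]"
      by (simp add: poly_const_pow)
  qed
  also have "\<dots> = [:\<Prod>i<N. x i ^ part l i:]"
    by (induction N) (auto simp: one_pCons)
  finally show ?thesis .
qed

lemma pCons_sum_0: "[:\<Sum>a\<in>A. f a:] = (\<Sum>a\<in>A. [:f a:])"
  by (rule poly_eqI) (simp add: coeff_sum coeff_pCons split: nat.split)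

lemma HL_sym_HLP:
  assumes "is_partition l" "length l \<le> N" "part l 0 \<le> L"
  shows "HL_sym N (\<lambda>x. \<Prod>j\<in>{1..L}. col_prod (conjp l j) x) x = [:vfac N l * HLP N l x:]"
proof -
  have "vfac N l * HLP N l x = (\<Sum>w | w permutes {..<N}. (\<Prod>i<N. (x \<circ> w) i ^ part l i) * HL_kernel N (x \<circ> w))"
    by (simp add: HLP_def HL_kernel_def)
  then show ?thesis
    unfolding HL_sym_def col_prod_conjp[OF assms] by (simp add: pCons_sum_0 mult.commute)
qed

lemma E_poly_permute:
  assumes "w permutes {..<N}"
  shows "E_poly N (x \<circ> w) = E_poly N x"
proof -
  have "E_poly N x = (\<Prod>i<N. (\<lambda>i. [:1, x i:]) (w i))"
    unfolding E_poly_def by (rule prod.permute[OF assms, unfolded o_def])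
  then show ?thesis
    by (simp add: E_poly_def)
qed

lemma HL_sym_E_poly: "HL_sym N (\<lambda>x. f x * E_poly N x) x = E_poly N x * HL_sym N f x"
  unfolding HL_sym_def sum_distrib_left
  by (intro sum.cong refl) (simp add: E_poly_permute mult.commute)

lemma prod_shift:
  fixes g :: "nat \<Rightarrow> 'a::comm_monoid_mult"
  shows "(\<Prod>j\<in>{1..L}. g (j - 1)) * g L = g 0 * (\<Prod>j\<in>{1..L}. g j)"
  by (induction L) (auto simp: mult_ac)

text \<open>Written in t-factorials, both kinds of binomial have in their denominators the numbers
  of boxes added to the columns (\<open>A\<close>) and the differences
  \<open>c j - conjp p (Suc j)\<close> (\<open>B\<close>); in the block expansion the latter occur
  shifted by one column. The remaining factorials are those of \<open>vfac N n\<close> and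
  \<open>vfac N p\<close>.\<close>

lemma Pieri_coefficient:
  assumes n: "is_partition n" and p: "is_partition p" and len: "length n \<le> N" "length p \<le> N"
    and np: "contained n p" and v: "vertical_strip p n" and L: "L = Suc (part n 0)"
    and c: "c = (\<lambda>j. if j = 0 then N else conjp n j)"
  shows "(\<Prod>j\<in>{1..L}. qbinom (c (j - 1) - c j) (conjp p j - c j) tt) * vfac N p = vfac N n * vs p n"
proof -
  have nL: "part n 0 \<le> L" and pL: "part p 0 \<le> L"
    using v by (auto simp: L vertical_strip_def)
  have le: "c j \<le> conjp p j" if "j \<in> {1..L}" for j
    using np that by (simp add: c contained_iff_conjp[OF n p])
  have ge: "conjp p j \<le> c (j - 1)" if j: "j \<in> {1..L}" for j
  proof (cases "j = 1")
    case True
    then show ?thesis using len conjp_1[OF p] by (simp add: c)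
  next
    case False
    then obtain i where "j = Suc i" "1 \<le> i"
      using j by (cases j) auto
    then show ?thesis
      using v by (simp add: c vertical_strip_iff_conjp[OF n p])
  qed
  have cL: "c L = 0" "c (Suc L) = 0" "conjp p (Suc L) = 0"
    using conjp_eq_0[OF n] conjp_eq_0[OF p] pL by (auto simp: c L)
  define A where "A = (\<Prod>j\<in>{1..L}. vm (conjp p j - c j))"
  define B where "B = (\<Prod>j\<in>{1..L}. vm (c j - conjp p (Suc j)))"
  define C where "C = (\<Prod>j\<in>{1..L}. vm (conjp p j - conjp p (Suc j)))"
  have nz: "A \<noteq> 0" "B \<noteq> 0"
    by (auto simp: A_def B_def)
  have "vs p n = (\<Prod>j\<in>{1..L}. vm (conjp p j - conjp p (Suc j)) / (vm (conjp p j - c j) * vm (c j - conjp p (Suc j))))"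
    unfolding vs_conjp[OF p n np v pL]
  proof (rule prod.cong[OF refl])
    fix j assume j: "j \<in> {1..L}"
    then have "conjp p (Suc j) \<le> c j"
      using v by (simp add: c vertical_strip_iff_conjp[OF n p])
    moreover have "c j = conjp n j"
      using j by (simp add: c)
    ultimately show "qbinom (conjp p j - conjp p (Suc j)) (conjp p j - conjp n j) tt
      = vm (conjp p j - conjp p (Suc j)) / (vm (conjp p j - c j) * vm (c j - conjp p (Suc j)))"
      using le[OF j] by (subst qbinom_vm) auto
  qed
  then have vs: "vs p n = C / (A * B)"
    by (simp add: A_def B_def C_def prod_dividef prod.distrib)
  have vn: "vfac N n = (\<Prod>j\<in>{1..L}. vm (c (j - 1) - c j))"
  proof -
    have "(\<Prod>j\<in>{1..L}. vm (c (j - 1) - c (Suc (j - 1)))) * vm (c L - c (Suc L))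
        = vm (c 0 - c (Suc 0)) * (\<Prod>j\<in>{1..L}. vm (c j - c (Suc j)))"
      by (rule prod_shift)
    moreover have "(\<Prod>j\<in>{1..L}. vm (c (j - 1) - c (Suc (j - 1)))) = (\<Prod>j\<in>{1..L}. vm (c (j - 1) - c j))"
      by (rule prod.cong) auto
    moreover have "(\<Prod>j\<in>{1..L}. vm (c j - c (Suc j))) = (\<Prod>j\<in>{1..L}. vm (conjp n j - conjp n (Suc j)))"
      by (rule prod.cong) (auto simp: c)
    moreover have "c 0 - c (Suc 0) = N - conjp n 1"
      by (simp add: c)
    ultimately show ?thesis
      by (simp add: vfac_conjp[OF n nL] cL del: One_nat_def)
  qed
  have B: "vm (N - conjp p 1) * B = (\<Prod>j\<in>{1..L}. vm (c (j - 1) - conjp p j))"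
  proof -
    have "(\<Prod>j\<in>{1..L}. vm (c (j - 1) - conjp p j)) = (\<Prod>j\<in>{1..L}. vm (c (j - 1) - conjp p (Suc (j - 1))))"
      by (rule prod.cong) auto
    also have "\<dots> = (\<Prod>j\<in>{1..L}. vm (c (j - 1) - conjp p (Suc (j - 1)))) * vm (c L - conjp p (Suc L))"
      by (simp add: cL)
    also have "\<dots> = vm (c 0 - conjp p (Suc 0)) * B"
      unfolding B_def by (rule prod_shift)
    also have "c 0 - conjp p (Suc 0) = N - conjp p 1"
      by (simp add: c)
    finally show ?thesis
      by (rule sym)
  qed
  have "(\<Prod>j\<in>{1..L}. qbinom (c (j - 1) - c j) (conjp p j - c j) tt)
      = (\<Prod>j\<in>{1..L}. vm (c (j - 1) - c j) / (vm (conjp p j - c j) * vm (c (j - 1) - conjp p j)))"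
  proof (rule prod.cong[OF refl])
    fix j assume j: "j \<in> {1..L}"
    show "qbinom (c (j - 1) - c j) (conjp p j - c j) tt
      = vm (c (j - 1) - c j) / (vm (conjp p j - c j) * vm (c (j - 1) - conjp p j))"
      using le[OF j] ge[OF j] by (subst qbinom_vm) auto
  qed
  also have "\<dots> = vfac N n / (A * (vm (N - conjp p 1) * B))"
    unfolding vn A_def B prod_dividef prod.distrib ..
  finally show ?thesis
    using nz by (simp add: vs vfac_conjp[OF p pL] C_def)
qed

text \<open>\<open>E_poly\<close> is symmetric, so it may be multiplied in before symmetrising the
  monomial of n. Then \<open>HL_sym_columns\<close> lets each column grow through the block below
  it, and \<open>Pieri_coefficient\<close> converts the normalisation.\<close>

theorem HLP_Pieri_poly:
  assumes n: "is_partition n" and len: "length n \<le> N" and inj: "inj_on x {..<N}"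
  shows "E_poly N x * [:HLP N n x:] = (\<Sum>p | is_partition p \<and> contained n p \<and> vertical_strip p n \<and> length p \<le> N.
    smult (vs p n * HLP N p x) ([:0, 1:] ^ (psize p - psize n)))"
proof -
  \<comment> \<open>A vertical strip can open one new column. Column 0 is given length N, which
    limits the first column by the number of variables.\<close>
  define L where "L = Suc (part n 0)"
  define c where "c = (\<lambda>j. if j = 0 then N else conjp n j)"
  let ?S = "{p. is_partition p \<and> part p 0 \<le> L \<and> (\<forall>j\<in>{1..L}. conjp p j \<in> {c j..c (j - 1)})}"
  have S: "?S = {p. is_partition p \<and> contained n p \<and> vertical_strip p n \<and> length p \<le> N}"
  proof safe
    fix p assume p: "is_partition p" and pL: "part p 0 \<le> L"
      and j: "\<forall>j\<in>{1..L}. conjp p j \<in> {c j..c (j - 1)}"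
    have "conjp n j \<le> conjp p j" if "1 \<le> j" for j
    proof (cases "j \<le> L")
      case True
      then show ?thesis using j that by (auto simp: c_def)
    next
      case False
      then show ?thesis using conjp_eq_0[OF n, of j] by (simp add: L_def)
    qed
    then show "contained n p" by (simp add: contained_iff_conjp[OF n p])
    have "conjp p (Suc j) \<le> conjp n j" if "1 \<le> j" for j
    proof (cases "Suc j \<le> L")
      case True
      then show ?thesis using j[rule_format, of "Suc j"] that by (auto simp: c_def)
    next
      case False
      then show ?thesis using conjp_eq_0[OF p, of "Suc j"] pL by simp
    qed
    then show "vertical_strip p n" by (simp add: vertical_strip_iff_conjp[OF n p])
    show "length p \<le> N"
      using j[rule_format, of 1] conjp_1[OF p] by (simp add: c_def L_def)
  next
    fix p j assume p: "is_partition p" and np: "contained n p" and v: "vertical_strip p n"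
      and len: "length p \<le> N"
    show "part p 0 \<le> L"
      using v by (auto simp: L_def vertical_strip_def)
    assume j: "j \<in> {1..L}"
    have "conjp p j \<le> c (j - 1)"
    proof (cases "j = 1")
      case True
      then show ?thesis using len conjp_1[OF p] by (simp add: c_def)
    next
      case False
      then obtain i where "j = Suc i" "1 \<le> i"
        using j by (cases j) auto
      then show ?thesis
        using v by (simp add: c_def vertical_strip_iff_conjp[OF n p])
    qed
    then show "conjp p j \<in> {c j..c (j - 1)}"
      using np j by (auto simp: c_def contained_iff_conjp[OF n p])
  qed
  have dec: "c (Suc j) \<le> c j" for j
    using conjp_antimono[of j "Suc j" n] conjp_Suc_0[OF n] len by (auto simp: c_def)
  have cL: "c L = 0"
    using conjp_eq_0[OF n] by (simp add: c_def L_def)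
  have c0: "c 0 = N"
    by (simp add: c_def)
  have nL: "part n 0 \<le> L"
    by (simp add: L_def)
  let ?q = "\<lambda>d j. qbinom (c (j - 1) - c j) (d j - c j) tt"
  have "E_poly N x * [:vfac N n * HLP N n x:]
      = HL_sym N (\<lambda>x. (\<Prod>j\<in>{1..L}. col_prod (conjp n j) x) * E_poly N x) x"
    unfolding HL_sym_E_poly HL_sym_HLP[OF n len nL] ..
  also have "\<dots> = HL_sym N (\<lambda>x. 1 * (\<Prod>j\<in>{1..L}. col_prod (c j) x) * (\<Prod>i\<in>{c L..<N}. [:1, x i:])) x"
  proof (rule HL_sym_cong)
    fix x :: "nat \<Rightarrow> Qt"
    have "(\<Prod>j\<in>{1..L}. col_prod (conjp n j) x) = (\<Prod>j\<in>{1..L}. col_prod (c j) x)"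
      by (rule prod.cong) (auto simp: c_def)
    then show "(\<Prod>j\<in>{1..L}. col_prod (conjp n j) x) * E_poly N x
      = 1 * (\<Prod>j\<in>{1..L}. col_prod (c j) x) * (\<Prod>i\<in>{c L..<N}. [:1, x i:])"
      by (simp add: E_poly_def cL lessThan_atLeast0)
  qed
  also have "\<dots> = (\<Sum>d\<in>PiE {1..L} (\<lambda>j. {c j..c (j - 1)}).
        (\<Prod>j\<in>{1..L}. [:?q d j:] * [:0, 1:] ^ (d j - c j))
        * HL_sym N (\<lambda>x. 1 * (\<Prod>j\<in>{1..L}. col_prod (d j) x)) x)"
    by (rule HL_sym_columns[OF c0 dec inj]) simp
  also have "\<dots> = (\<Sum>p\<in>?S.
        (\<Prod>j\<in>{1..L}. [:?q (restrict (conjp p) {1..L}) j:] * [:0, 1:] ^ (restrict (conjp p) {1..L} j - c j))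
        * HL_sym N (\<lambda>x. 1 * (\<Prod>j\<in>{1..L}. col_prod (restrict (conjp p) {1..L} j) x)) x)"
    by (rule sum.reindex_bij_betw[OF bij_betw_conjp_PiE, symmetric]) (use dec in simp)
  also have "\<dots> = (\<Sum>p\<in>?S. smult (vfac N n) (smult (vs p n * HLP N p x) ([:0, 1:] ^ (psize p - psize n))))"
  proof (rule sum.cong[OF refl])
    fix p assume "p \<in> ?S"
    then have p: "is_partition p" and np: "contained n p" and v: "vertical_strip p n"
      and lenp: "length p \<le> N" and pL: "part p 0 \<le> L"
      and pj: "\<forall>j\<in>{1..L}. conjp p j \<in> {c j..c (j - 1)}"
      using S by auto
    have "(\<Prod>j\<in>{1..L}. [:?q (restrict (conjp p) {1..L}) j:] * [:0, 1:] ^ (restrict (conjp p) {1..L} j - c j))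
        = (\<Prod>j\<in>{1..L}. smult (?q (conjp p) j) ([:0, 1:] ^ (conjp p j - c j)))"
      by (rule prod.cong) auto
    also have "\<dots> = smult (\<Prod>j\<in>{1..L}. ?q (conjp p) j) ([:0, 1:] ^ (\<Sum>j\<in>{1..L}. conjp p j - c j))"
      by (simp add: prod_smult power_sum)
    also have "(\<Sum>j\<in>{1..L}. conjp p j - c j) = (\<Sum>j\<in>{1..L}. conjp p j) - (\<Sum>j\<in>{1..L}. c j)"
      by (rule sum_subtractf_nat) (use pj in auto)
    also have "(\<Sum>j\<in>{1..L}. c j) = psize n"
      unfolding psize_conjp[OF n nL] by (rule sum.cong) (auto simp: c_def)
    also have "(\<Sum>j\<in>{1..L}. conjp p j) = psize p"
      by (rule psize_conjp[OF p pL, symmetric])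
    finally have 1: "(\<Prod>j\<in>{1..L}. [:?q (restrict (conjp p) {1..L}) j:] * [:0, 1:] ^ (restrict (conjp p) {1..L} j - c j))
        = smult (\<Prod>j\<in>{1..L}. ?q (conjp p) j) ([:0, 1:] ^ (psize p - psize n))" .
    have 2: "HL_sym N (\<lambda>x. 1 * (\<Prod>j\<in>{1..L}. col_prod (restrict (conjp p) {1..L} j) x)) x
        = [:vfac N p * HLP N p x:]"
      unfolding HL_sym_HLP[OF p lenp pL, symmetric] by (rule HL_sym_cong) simp
    have 3: "(\<Prod>j\<in>{1..L}. ?q (conjp p) j) * vfac N p = vfac N n * vs p n"
      by (rule Pieri_coefficient[OF n p len lenp np v L_def c_def])
    have 4: "smult a Y * [:b:] = smult (a * b) Y" for a b :: Qt and Y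
      by (simp add: mult.commute)
    have 5: "(\<Prod>j\<in>{1..L}. ?q (conjp p) j) * (vfac N p * HLP N p x) = vfac N n * (vs p n * HLP N p x)"
      using arg_cong[OF 3, of "\<lambda>u. u * HLP N p x"] by (simp only: mult.assoc)
    show "(\<Prod>j\<in>{1..L}. [:?q (restrict (conjp p) {1..L}) j:] * [:0, 1:] ^ (restrict (conjp p) {1..L} j - c j))
        * HL_sym N (\<lambda>x. 1 * (\<Prod>j\<in>{1..L}. col_prod (restrict (conjp p) {1..L} j) x)) x
        = smult (vfac N n) (smult (vs p n * HLP N p x) ([:0, 1:] ^ (psize p - psize n)))"
      unfolding 1 2 4 5 by simp
  qed
  also have "\<dots> = smult (vfac N n) (\<Sum>p\<in>?S. smult (vs p n * HLP N p x) ([:0, 1:] ^ (psize p - psize n)))"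
    by (rule smult_sum_right[symmetric])
  finally have "smult (vfac N n) (E_poly N x * [:HLP N n x:])
      = smult (vfac N n) (\<Sum>p\<in>?S. smult (vs p n * HLP N p x) ([:0, 1:] ^ (psize p - psize n)))"
    by simp
  then have "E_poly N x * [:HLP N n x:] = (\<Sum>p\<in>?S. smult (vs p n * HLP N p x) ([:0, 1:] ^ (psize p - psize n)))"
    by (rule smult_cancel[OF vfac_nonzero])
  then show ?thesis unfolding S .
qed

section \<open>The Pieri rule in a single degree\<close>

lemma monom_1_conv: "[:0, 1:] ^ k = monom 1 k"
  by (simp add: monom_altdef)

definition esym :: "nat \<Rightarrow> (nat \<Rightarrow> Qt) \<Rightarrow> nat \<Rightarrow> Qt" where
  "esym N x r = coeff (E_poly N x) r"

lemma esym_0 [simp]: "esym N x 0 = 1"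
proof -
  have "poly (E_poly N x) 0 = 1"
    by (simp add: E_poly_def poly_prod)
  then show ?thesis
    by (simp add: esym_def poly_0_coeff_0)
qed

text \<open>The coefficient of y^r. Since a partition of size at most N has at most N parts, the
  condition on the length disappears; partitions that do not form a vertical strip may enter because
  \<open>vs\<close> is 0 there.\<close>

theorem HLP_Pieri:
  assumes n: "is_partition n" and N: "psize n + r \<le> N" and inj: "inj_on x {..<N}"
  shows "esym N x r * HLP N n x = (\<Sum>p | p \<in> partitions_of (psize n + r) \<and> contained n p. vs p n * HLP N p x)"
proof -
  let ?S = "{p. is_partition p \<and> contained n p \<and> vertical_strip p n \<and> length p \<le> N}"
  have "length n \<le> N"
    using length_le_psize[OF n] N by simp
  have fin: "finite ?S"
  proof (rule finite_subset)
    show "?S \<subseteq> {p. set p \<subseteq> {..part n 0 + 1} \<and> length p \<le> N}"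
    proof safe
      fix p y assume p: "is_partition p" "vertical_strip p n" and "y \<in> set p"
      then obtain i where "y = part p i"
        by (auto simp: in_set_conv_nth part_def) metis
      then have "y \<le> part p 0"
        using part_le_part_0[OF p(1)] by simp
      also have "\<dots> \<le> part n 0 + 1"
        using p by (simp add: vertical_strip_def)
      finally show "y \<le> part n 0 + 1" .
    qed
    show "finite {p. set p \<subseteq> {..part n 0 + 1} \<and> length p \<le> N}"
      by (rule finite_lists_length_le) simp
  qed
  have "esym N x r * HLP N n x = coeff (E_poly N x * [:HLP N n x:]) r"
    by (simp add: esym_def mult.commute)
  also have "\<dots> = (\<Sum>p\<in>?S. vs p n * HLP N p x * (if psize p - psize n = r then 1 else 0))"
    unfolding HLP_Pieri_poly[OF n \<open>length n \<le> N\<close> inj] coeff_sum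
    by (intro sum.cong refl) (simp add: monom_1_conv coeff_monom)
  also have "\<dots> = (\<Sum>p\<in>{p\<in>?S. psize p - psize n = r}. vs p n * HLP N p x)"
    unfolding sum.inter_filter[OF fin] by (intro sum.cong refl) auto
  also have "\<dots> = (\<Sum>p | p \<in> partitions_of (psize n + r) \<and> contained n p. vs p n * HLP N p x)"
  proof (rule sum.mono_neutral_left)
    show "finite {p. p \<in> partitions_of (psize n + r) \<and> contained n p}"
      by (rule finite_subset[of _ "partitions_of (psize n + r)"]) auto
    show "{p\<in>?S. psize p - psize n = r} \<subseteq> {p. p \<in> partitions_of (psize n + r) \<and> contained n p}"
      using contained_psize_le[OF n] by (auto simp: partitions_of_def)
    show "\<forall>p\<in>{p. p \<in> partitions_of (psize n + r) \<and> contained n p} - {p\<in>?S. psize p - psize n = r}.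
        vs p n * HLP N p x = 0"
    proof
      fix p assume p: "p \<in> {p. p \<in> partitions_of (psize n + r) \<and> contained n p} - {p\<in>?S. psize p - psize n = r}"
      then have "is_partition p" "psize p = psize n + r"
        by (auto simp: partitions_of_def)
      moreover have "length p \<le> N"
        using length_le_psize[of p] calculation N by simp
      ultimately have "\<not> vertical_strip p n"
        using p by auto
      then show "vs p n * HLP N p x = 0"
        by (simp add: vs_def)
    qed
  qed
  finally show ?thesis .
qed

section \<open>The Hall--Littlewood polynomial of the empty partition\<close>

text \<open>Partial fractions in Z: each factor tends to q at infinity, and (1 - q) b times the
  remaining product is the coefficient of 1 / (b - Z) at the pole Z = b.\<close>

lemma prod_partial_fractions:
  fixes q :: "'a::field"
  assumes "finite A" "Z \<notin> A"
  shows "(\<Prod>a\<in>A. (a - q * Z) / (a - Z))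
    = q ^ card A + (\<Sum>b\<in>A. (1 - q) * b * (\<Prod>a\<in>A - {b}. (a - q * b) / (a - b)) / (b - Z))"
  using assms
proof (induction A arbitrary: Z rule: finite_induct)
  case (insert u A)
  define C where "C b = (\<Prod>a\<in>A - {b}. (a - q * b) / (a - b))" for b
  define S where "S Z = (\<Sum>b\<in>A. (1 - q) * b * C b / (b - Z))" for Z
  have IH: "(\<Prod>a\<in>A. (a - q * Z) / (a - Z)) = q ^ card A + S Z" if "Z \<notin> A" for Z
    unfolding S_def C_def using insert.IH that by simp
  have uZ: "u - Z \<noteq> 0" using insert.prems by auto
  have C': "(\<Prod>a\<in>insert u A - {b}. (a - q * b) / (a - b)) = (u - q * b) / (u - b) * C b" if "b \<in> A" for b
  proof -
    have "insert u A - {b} = insert u (A - {b})"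
      using that insert.hyps by auto
    then show ?thesis
      using insert.hyps by (simp add: C_def)
  qed
  have "(\<Prod>a\<in>insert u A - {u}. (a - q * u) / (a - u)) = q ^ card A + S u"
    using insert.hyps IH[of u] by simp
  moreover have "(\<Sum>b\<in>A. (1 - q) * b * (\<Prod>a\<in>insert u A - {b}. (a - q * b) / (a - b)) / (b - Z))
      = (\<Sum>b\<in>A. (u - q * Z) / (u - Z) * ((1 - q) * b * C b / (b - Z))
          - (1 - q) * u / (u - Z) * ((1 - q) * b * C b / (b - u)))"
  proof (rule sum.cong[OF refl])
    fix b assume b: "b \<in> A"
    have "b \<noteq> Z" "b \<noteq> u" using b insert by auto
    \<comment> \<open>With u - Z, b - Z and u - b as \<alpha>, \<beta> and \<gamma>, only a
      polynomial identity between numerators is left.\<close>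
    have partial: "n1 / \<gamma> / \<beta> = n2 / \<alpha> / \<beta> + n3 / \<alpha> / \<gamma>"
      if "n1 * \<alpha> = n2 * \<gamma> + n3 * \<beta>" "\<alpha> \<noteq> 0" "\<beta> \<noteq> 0" "\<gamma> \<noteq> 0" for n1 n2 n3 \<alpha> \<beta> \<gamma> :: 'a
      using that by (simp add: field_simps)
    have "(u - q * b) / (u - b) / (b - Z) = (u - q * Z) / (u - Z) / (b - Z) + (1 - q) * u / (u - Z) / (u - b)"
      using \<open>b \<noteq> Z\<close> \<open>b \<noteq> u\<close> uZ by (intro partial) (auto simp: algebra_simps)
    also have "(1 - q) * u / (u - Z) / (u - b) = - ((1 - q) * u / (u - Z) / (b - u))"
      unfolding minus_divide_right by simp
    finally have "(u - q * b) / (u - b) / (b - Z)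
        = (u - q * Z) / (u - Z) / (b - Z) - (1 - q) * u / (u - Z) / (b - u)"
      by simp
    from arg_cong[OF this, of "\<lambda>r. (1 - q) * b * C b * r"]
    show "(1 - q) * b * (\<Prod>a\<in>insert u A - {b}. (a - q * b) / (a - b)) / (b - Z)
      = (u - q * Z) / (u - Z) * ((1 - q) * b * C b / (b - Z))
          - (1 - q) * u / (u - Z) * ((1 - q) * b * C b / (b - u))"
      unfolding C'[OF b] right_diff_distrib by (simp add: mult_ac)
  qed
  moreover have "\<dots> = (u - q * Z) / (u - Z) * S Z - (1 - q) * u / (u - Z) * S u"
    unfolding S_def sum_subtractf sum_distrib_left ..
  ultimately have "q ^ card (insert u A) + (\<Sum>b\<in>insert u A. (1 - q) * b * (\<Prod>a\<in>insert u A - {b}. (a - q * b) / (a - b)) / (b - Z))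
      = q * q ^ card A + ((1 - q) * u * (q ^ card A + S u) / (u - Z)
        + ((u - q * Z) / (u - Z) * S Z - (1 - q) * u / (u - Z) * S u))"
    using insert.hyps by simp
  also have "\<dots> = (q + (1 - q) * u / (u - Z)) * q ^ card A + (u - q * Z) / (u - Z) * S Z"
    by (simp add: ring_distribs add_divide_distrib)
  also have "q + (1 - q) * u / (u - Z) = (u - q * Z) / (u - Z)"
    using uZ by (simp add: field_simps)
  also have "(u - q * Z) / (u - Z) * q ^ card A + (u - q * Z) / (u - Z) * S Z
      = (\<Prod>a\<in>insert u A. (a - q * Z) / (a - Z))"
    using insert.hyps insert.prems IH[of Z] by (simp add: distrib_left)
  finally show ?case ..
qed simp

text \<open>The sum does not depend on the points. When u is added, the corrections to the old
  summands are the terms of the partial fractions at Z = u, and they cancel against the new summand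
  except for q^|A|.\<close>

lemma sum_prod_ratio:
  fixes q :: "'a::field"
  assumes "finite A" "q \<noteq> 1"
  shows "(\<Sum>b\<in>A. \<Prod>a\<in>A - {b}. (a - q * b) / (a - b)) = (1 - q ^ card A) / (1 - q)"
  using assms(1)
proof (induction A rule: finite_induct)
  case (insert u A)
  define C where "C b = (\<Prod>a\<in>A - {b}. (a - q * b) / (a - b))" for b
  have C': "(\<Prod>a\<in>insert u A - {b}. (a - q * b) / (a - b)) = C b - (1 - q) * b * C b / (b - u)" if b: "b \<in> A" for b
  proof -
    have "insert u A - {b} = insert u (A - {b})"
      using that insert.hyps by auto
    then have "(\<Prod>a\<in>insert u A - {b}. (a - q * b) / (a - b)) = (u - q * b) / (u - b) * C b"
      using insert.hyps by (simp add: C_def)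
    moreover have "(u - q * b) / (u - b) = 1 - (1 - q) * b / (b - u)"
    proof -
      have "b \<noteq> u" using b insert by auto
      then show ?thesis by (simp add: field_simps)
    qed
    ultimately show ?thesis
      by (simp add: left_diff_distrib)
  qed
  have "(\<Sum>b\<in>insert u A. \<Prod>a\<in>insert u A - {b}. (a - q * b) / (a - b))
      = (\<Prod>a\<in>A. (a - q * u) / (a - u)) + (\<Sum>b\<in>A. C b - (1 - q) * b * C b / (b - u))"
    using insert.hyps C' by simp
  also have "\<dots> = q ^ card A + (\<Sum>b\<in>A. C b)"
    unfolding prod_partial_fractions[OF insert.hyps] sum_subtractf C_def by simp
  also have "\<dots> = (1 - q ^ card (insert u A)) / (1 - q)"
    unfolding C_def insert.IH using insert.hyps assms(2) by (simp add: field_simps)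
  finally show ?case .
qed simp

text \<open>Permutations are grouped by their value b at the last position. The product over the
  pairs involving that position depends only on b, the other pairs sum to \<open>vm N\<close> by
  induction, and \<open>sum_prod_ratio\<close> supplies the missing factor of
  \<open>vm (Suc N)\<close>.\<close>

lemma sum_HL_kernel:
  "inj_on x {..<N} \<Longrightarrow> (\<Sum>w | w permutes {..<N}. HL_kernel N (x \<circ> w)) = vm N"
proof (induction N arbitrary: x)
  case 0
  then show ?case by (simp add: HL_kernel_def)
next
  case (Suc N)
  have K: "HL_kernel (Suc N) z = HL_kernel N z * (\<Prod>i<N. (z i - tt * z N) / (z i - z N))" for z
  proof -
    have S: "{(i, j). i < j \<and> j < Suc N} = {(i, j). i < j \<and> j < N} \<union> (\<lambda>i. (i, N)) ` {..<N}"
      by auto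
    have "HL_kernel (Suc N) z = HL_kernel N z
        * (\<Prod>(i, j)\<in>(\<lambda>i. (i, N)) ` {..<N}. (z i - tt * z j) / (z i - z j))"
      unfolding HL_kernel_def S by (rule prod.union_disjoint) auto
    then show ?thesis
      by (simp add: prod.reindex inj_on_def)
  qed
  have "(\<Sum>w | w permutes {..<Suc N}. HL_kernel (Suc N) (x \<circ> w))
      = (\<Sum>b\<in>insert N {..<N}. \<Sum>q | q permutes {..<N}. HL_kernel (Suc N) (x \<circ> (transpose N b \<circ> q)))"
    unfolding lessThan_Suc by (rule sum_over_permutations_insert) auto
  also have "\<dots> = (\<Sum>b<Suc N. vm N * (\<Prod>a\<in>x ` {..<Suc N} - {x b}. (a - tt * x b) / (a - x b)))"
    unfolding lessThan_Suc
  proof (rule sum.cong[OF refl])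
    fix b assume "b \<in> insert N {..<N}"
    then have b: "b < Suc N" by auto
    let ?z = "x \<circ> transpose N b"
    have tr: "transpose N b permutes {..<Suc N}"
      using b by (intro permutes_swap_id) auto
    have inj_z: "inj_on ?z {..<Suc N}"
      using permutes_inj_on[OF tr] Suc.prems permutes_image[OF tr] by (intro comp_inj_on) auto
    have zN: "?z N = x b" by simp
    have im: "?z ` {..<N} = x ` {..<Suc N} - {x b}"
    proof -
      have "?z ` {..<Suc N} = x ` {..<Suc N}"
        by (simp only: image_comp[symmetric] permutes_image[OF tr])
      moreover have "?z ` {..<Suc N} = insert (?z N) (?z ` {..<N})"
        by (simp only: lessThan_Suc image_insert)
      moreover have "?z N \<notin> ?z ` {..<N}"
        using inj_z by (auto simp del: o_apply dest: inj_onD)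
      ultimately show ?thesis
        using zN by auto
    qed
    have inj_z': "inj_on ?z {..<N}"
      by (rule inj_on_subset[OF inj_z]) auto
    have "(\<Sum>q | q permutes {..<N}. HL_kernel (Suc N) (x \<circ> (transpose N b \<circ> q)))
      = (\<Sum>q | q permutes {..<N}. HL_kernel N (?z \<circ> q) * (\<Prod>i<N. (?z i - tt * ?z N) / (?z i - ?z N)))"
    proof (rule sum.cong[OF refl], safe)
      fix q assume q: "q permutes {..<N}"
      have "(?z \<circ> q) N = ?z N"
        using permutes_not_in[OF q, of N] by simp
      moreover have "(\<Prod>i<N. (?z i - tt * ?z N) / (?z i - ?z N)) = (\<Prod>i<N. ((?z \<circ> q) i - tt * ?z N) / ((?z \<circ> q) i - ?z N))"
        using prod.permute[OF q, of "\<lambda>i. (?z i - tt * ?z N) / (?z i - ?z N)"] by (simp add: o_def)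
      ultimately have "HL_kernel (Suc N) (?z \<circ> q) = HL_kernel N (?z \<circ> q) * (\<Prod>i<N. (?z i - tt * ?z N) / (?z i - ?z N))"
        unfolding K by (simp only:)
      then show "HL_kernel (Suc N) (x \<circ> (transpose N b \<circ> q))
          = HL_kernel N (?z \<circ> q) * (\<Prod>i<N. (?z i - tt * ?z N) / (?z i - ?z N))"
        by (simp only: o_assoc)
    qed
    also have "\<dots> = vm N * (\<Prod>i<N. (?z i - tt * x b) / (?z i - x b))"
      unfolding sum_distrib_right[symmetric] Suc.IH[OF inj_z'] zN ..
    also have "(\<Prod>i<N. (?z i - tt * x b) / (?z i - x b)) = (\<Prod>a\<in>?z ` {..<N}. (a - tt * x b) / (a - x b))"
      by (subst prod.reindex[OF inj_z']) (simp add: o_def)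
    finally show "(\<Sum>q | q permutes {..<N}. HL_kernel (Suc N) (x \<circ> (transpose N b \<circ> q)))
      = vm N * (\<Prod>a\<in>x ` insert N {..<N} - {x b}. (a - tt * x b) / (a - x b))"
      unfolding im lessThan_Suc .
  qed
  also have "\<dots> = vm N * (\<Sum>c\<in>x ` {..<Suc N}. \<Prod>a\<in>x ` {..<Suc N} - {c}. (a - tt * c) / (a - c))"
    by (simp only: sum.reindex[OF Suc.prems] o_def sum_distrib_left)
  also have "\<dots> = vm (Suc N)"
    using Suc.prems by (simp add: sum_prod_ratio card_image vm_Suc)
  finally show ?case .
qed

lemma HLP_Nil:
  assumes "inj_on x {..<N}"
  shows "HLP N [] x = 1"
proof -
  have "HLP N [] x = 1 / vm N * (\<Sum>w | w permutes {..<N}. HL_kernel N (x \<circ> w))"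
    by (simp add: HLP_def HL_kernel_def vfac_def)
  then show ?thesis
    using sum_HL_kernel[OF assms] by simp
qed

section \<open>Linear independence\<close>

text \<open>A permutation acts on unordered pairs; min and max select the ordered
  representative.\<close>

lemma prod_pairs_permute:
  fixes h :: "nat \<Rightarrow> nat \<Rightarrow> 'a::comm_monoid_mult"
  assumes sym: "\<And>a b. h a b = h b a" and w: "w permutes {..<N}"
  shows "(\<Prod>(i, j)\<in>{(i, j). i < j \<and> j < N}. h (w i) (w j)) = (\<Prod>(i, j)\<in>{(i, j). i < j \<and> j < N}. h i j)"
proof (rule prod.reindex_bij_witness[of _ "\<lambda>(i, j). (min (inv w i) (inv w j), max (inv w i) (inv w j))"
      "\<lambda>(i, j). (min (w i) (w j), max (w i) (w j))"])
  have w_less: "w i < N \<longleftrightarrow> i < N" "inv w i < N \<longleftrightarrow> i < N" for i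
    using permutes_in_image[OF w, of i] permutes_in_image[OF permutes_inv[OF w], of i] by auto
  have w_eq: "w i = w j \<longleftrightarrow> i = j" "inv w i = inv w j \<longleftrightarrow> i = j" for i j
    using permutes_inj[OF w] permutes_inj[OF permutes_inv[OF w]] by (auto dest: injD)
  fix a
  { assume "a \<in> {(i, j). i < j \<and> j < N}"
    then obtain i j where a: "a = (i, j)" "i < j" "j < N" by auto
    then have "w i \<noteq> w j" "inv w i \<noteq> inv w j" by (auto simp: w_eq)
    then show "(case case a of (i, j) \<Rightarrow> (min (w i) (w j), max (w i) (w j)) of
          (i, j) \<Rightarrow> (min (inv w i) (inv w j), max (inv w i) (inv w j))) = a"
      "(case case a of (i, j) \<Rightarrow> (min (inv w i) (inv w j), max (inv w i) (inv w j)) of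
          (i, j) \<Rightarrow> (min (w i) (w j), max (w i) (w j))) = a"
      "(case a of (i, j) \<Rightarrow> (min (w i) (w j), max (w i) (w j))) \<in> {(i, j). i < j \<and> j < N}"
      "(case a of (i, j) \<Rightarrow> (min (inv w i) (inv w j), max (inv w i) (inv w j))) \<in> {(i, j). i < j \<and> j < N}"
      "(case case a of (i, j) \<Rightarrow> (min (w i) (w j), max (w i) (w j)) of (i, j) \<Rightarrow> h i j) = (case a of (i, j) \<Rightarrow> h (w i) (w j))"
      using a by (auto simp: min_def max_def permutes_inverses[OF w] w_less sym) }
qed

lemma sum_pairs_permute:
  fixes h :: "nat \<Rightarrow> nat \<Rightarrow> nat"
  assumes "\<And>a b. h a b = h b a" "w permutes {..<N}"
  shows "(\<Sum>(i, j)\<in>{(i, j). i < j \<and> j < N}. h (w i) (w j)) = (\<Sum>(i, j)\<in>{(i, j). i < j \<and> j < N}. h i j)"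
proof -
  \<comment> \<open>Turns the version for products into one for sums, since a power of 2 determines
    its exponent.\<close>
  have "(2::nat) ^ (\<Sum>(i, j)\<in>{(i, j). i < j \<and> j < N}. h (w i) (w j)) = 2 ^ (\<Sum>(i, j)\<in>{(i, j). i < j \<and> j < N}. h i j)"
    using prod_pairs_permute[of "\<lambda>i j. (2::nat) ^ h i j", OF _ assms(2)] assms(1)
    by (simp add: power_sum case_prod_unfold)
  then show ?thesis
    by simp
qed

lemma coeff_mult_sum_bounds:
  fixes p q :: "'a::comm_semiring_1 poly"
  assumes p: "degree p \<le> m" and q: "degree q \<le> n"
  shows "coeff (p * q) (m + n) = coeff p m * coeff q n"
proof -
  have zero: "coeff p i * coeff q (m + n - i) = 0" if "i \<in> {..m + n} - {m}" for i
  proof (cases "i < m")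
    case True
    then have "coeff q (m + n - i) = 0"
      using q by (intro coeff_eq_0) simp
    then show ?thesis by simp
  next
    case False
    then have "coeff p i = 0"
      using p that by (intro coeff_eq_0) auto
    then show ?thesis by simp
  qed
  have "coeff (p * q) (m + n) = coeff p m * coeff q (m + n - m) + (\<Sum>i\<in>{..m + n} - {m}. coeff p i * coeff q (m + n - i))"
    unfolding coeff_mult by (rule sum.remove) auto
  then show ?thesis
    using sum.neutral[of "{..m + n} - {m}" "\<lambda>i. coeff p i * coeff q (m + n - i)"] zero by simp
qed

lemma coeff_prod_top:
  fixes p :: "'b \<Rightarrow> 'a::comm_semiring_1 poly"
  assumes "\<And>i. i \<in> A \<Longrightarrow> degree (p i) \<le> d i"
  shows "degree (prod p A) \<le> sum d A \<and> coeff (prod p A) (sum d A) = (\<Prod>i\<in>A. coeff (p i) (d i))"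
  using assms
proof (induction A rule: infinite_finite_induct)
  case (insert a A)
  then have IH: "degree (prod p A) \<le> sum d A" "coeff (prod p A) (sum d A) = (\<Prod>i\<in>A. coeff (p i) (d i))"
    and a: "degree (p a) \<le> d a"
    by auto
  have "degree (p a * prod p A) \<le> d a + sum d A"
    using degree_mult_le[of "p a" "prod p A"] IH(1) a by linarith
  moreover have "coeff (p a * prod p A) (d a + sum d A) = coeff (p a) (d a) * coeff (prod p A) (sum d A)"
    by (rule coeff_mult_sum_bounds) (use IH(1) a in auto)
  ultimately show ?case
    using insert.hyps IH(2) by simp
qed auto

lemma digits_unique:
  fixes B :: nat
  assumes "(\<Sum>a<n. B ^ a * f a) = (\<Sum>a<n. B ^ a * g a)" "\<And>a. f a < B" "\<And>a. g a < B" "a < n"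
  shows "f a = g a"
  using assms
proof (induction n arbitrary: f g a)
  case (Suc n)
  have split: "(\<Sum>a<Suc n. B ^ a * h a) = h 0 + B * (\<Sum>a<n. B ^ a * h (Suc a))" for h
    by (subst sum.lessThan_Suc_shift) (simp add: sum_distrib_left mult_ac)
  have B: "0 < B" using Suc.prems(2)[of 0] by simp
  have eq: "f 0 + B * (\<Sum>a<n. B ^ a * f (Suc a)) = g 0 + B * (\<Sum>a<n. B ^ a * g (Suc a))"
    using Suc.prems(1) unfolding split .
  have f0: "f 0 = g 0"
    using arg_cong[OF eq, of "\<lambda>m. m mod B"] Suc.prems(2)[of 0] Suc.prems(3)[of 0] by simp
  then have "(\<Sum>a<n. B ^ a * f (Suc a)) = (\<Sum>a<n. B ^ a * g (Suc a))"
    using eq B by simp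
  moreover have "f (Suc b) = g (Suc b)" if "b < n" for b
    using Suc.IH[of "\<lambda>a. f (Suc a)" "\<lambda>a. g (Suc a)" b] \<open>b < n\<close> Suc.prems(2,3) calculation by simp
  ultimately show ?case
    using f0 Suc.prems(4) by (cases a) auto
qed simp

text \<open>Column lengths ignore the order of the rows, so a partition can be recovered from any
  rearrangement of its parts.\<close>

lemma conjp_card_permute:
  assumes k: "is_partition k" and len: "length k \<le> N" and w: "w permutes {..<N}" and j: "1 \<le> j"
  shows "conjp k j = card {a\<in>{..<N}. j \<le> part k (inv w a)}"
proof -
  have "conjp k j \<le> N"
    using conjp_antimono[of 1 j k] conjp_1[OF k] len j by simp
  then have "{..<conjp k j} = {i\<in>{..<N}. j \<le> part k i}"
    using less_conjp_iff[OF k j] by force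
  then have "conjp k j = card {i\<in>{..<N}. j \<le> part k i}"
    using card_lessThan[of "conjp k j"] by simp
  also have "\<dots> = card (w ` {i\<in>{..<N}. j \<le> part k i})"
    by (rule card_image[symmetric]) (rule inj_on_subset[OF permutes_inj[OF w]], simp)
  also have "w ` {i\<in>{..<N}. j \<le> part k i} = {a\<in>{..<N}. j \<le> part k (inv w a)}"
  proof (rule set_eqI)
    fix a
    have "a \<in> w ` X \<longleftrightarrow> inv w a \<in> X" for X
    proof
      show "a \<in> w ` X \<Longrightarrow> inv w a \<in> X"
        by (erule imageE) (simp only: permutes_inverses(2)[OF w])
      show "inv w a \<in> X \<Longrightarrow> a \<in> w ` X"
        by (erule rev_image_eqI) (simp only: permutes_inverses(1)[OF w])
    qed
    from this[of "{i\<in>{..<N}. j \<le> part k i}"]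
    show "a \<in> w ` {i\<in>{..<N}. j \<le> part k i} \<longleftrightarrow> a \<in> {a\<in>{..<N}. j \<le> part k (inv w a)}"
      using permutes_in_image[OF permutes_inv[OF w], of a] by simp
  qed
  finally show ?thesis .
qed

lemma infinite_range_tt_power: "infinite (range (\<lambda>k. tt ^ Suc k))"
proof (rule range_inj_infinite, rule injI)
  fix a b assume "tt ^ Suc a = tt ^ Suc b"
  then show "a = b"
    using power_inject_exp[OF tt_gt_1, of "Suc a" "Suc b"] by simp
qed

text \<open>The product over pairs is the discriminant up to sign. It is symmetric, so for each w it
  can be rewritten in the variables permuted by w, where it contains all denominators of that
  summand.\<close>

lemma HLP_discriminant:
  assumes inj: "inj_on x {..<N}"
  shows "HLP N k x * (\<Prod>(i, j)\<in>{(i, j). i < j \<and> j < N}. (x i - x j) * (x j - x i))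
    = 1 / vfac N k * (\<Sum>w | w permutes {..<N}. (\<Prod>i<N. x (w i) ^ part k i)
      * (\<Prod>(i, j)\<in>{(i, j). i < j \<and> j < N}. (x (w i) - tt * x (w j)) * (x (w j) - x (w i))))"
proof -
  let ?P = "{(i, j). i < j \<and> j < N}"
  have "(\<Prod>(i, j)\<in>?P. (x (w i) - tt * x (w j)) / (x (w i) - x (w j))) * (\<Prod>(i, j)\<in>?P. (x i - x j) * (x j - x i))
      = (\<Prod>(i, j)\<in>?P. (x (w i) - tt * x (w j)) * (x (w j) - x (w i)))" if w: "w permutes {..<N}" for w
  proof -
    have "(\<Prod>(i, j)\<in>?P. (x i - x j) * (x j - x i)) = (\<Prod>(i, j)\<in>?P. (x (w i) - x (w j)) * (x (w j) - x (w i)))"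
      by (rule prod_pairs_permute[OF _ w, symmetric]) (simp add: mult.commute)
    then have "(\<Prod>(i, j)\<in>?P. (x (w i) - tt * x (w j)) / (x (w i) - x (w j))) * (\<Prod>(i, j)\<in>?P. (x i - x j) * (x j - x i))
      = (\<Prod>p\<in>?P. (case p of (i, j) \<Rightarrow> (x (w i) - tt * x (w j)) / (x (w i) - x (w j)))
          * (case p of (i, j) \<Rightarrow> (x (w i) - x (w j)) * (x (w j) - x (w i))))"
      by (simp only: prod.distrib)
    also have "\<dots> = (\<Prod>(i, j)\<in>?P. (x (w i) - tt * x (w j)) * (x (w j) - x (w i)))"
    proof (rule prod.cong[OF refl])
      fix p assume "p \<in> ?P"
      then obtain i j where p: "p = (i, j)" and ij: "i < j" "j < N" by auto
      have "w i \<noteq> w j" "w i < N" "w j < N"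
        using ij permutes_in_image[OF w] permutes_inj[OF w] by (auto dest: injD)
      then have "x (w i) = x (w j) \<Longrightarrow> False"
        using inj by (auto dest: inj_onD)
      then have "x (w i) - x (w j) \<noteq> 0"
        by auto
      then show "(case p of (i, j) \<Rightarrow> (x (w i) - tt * x (w j)) / (x (w i) - x (w j)))
          * (case p of (i, j) \<Rightarrow> (x (w i) - x (w j)) * (x (w j) - x (w i)))
        = (case p of (i, j) \<Rightarrow> (x (w i) - tt * x (w j)) * (x (w j) - x (w i)))"
        unfolding p by simp
    qed
    finally show ?thesis .
  qed
  then show ?thesis
    unfolding HLP_def by (simp add: sum_distrib_right mult.assoc)
qed

text \<open>Substitute \<open>x\<^sub>a = z ^ (B ^ a)\<close> and clear denominators. As the parts are digits in base \<open>B\<close>, only one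
  partition contributes to the highest power of \<open>z\<close>, and its coefficient is, up to sign, a nonempty sum of
  powers of \<open>t\<close>, which is positive in the ordered field \<open>Qt\<close>.\<close>

theorem HLP_linear_independent:
  assumes rel: "\<And>x. inj_on x {..<N} \<Longrightarrow> (\<Sum>k\<in>partitions_of N. c k * HLP N k x) = 0"
    and k: "k \<in> partitions_of N"
  shows "c k = 0"
proof (rule ccontr)
  assume "c k \<noteq> 0"
  \<comment> \<open>Parts are at most N and hence digits in base B. Taking N + 2 keeps B above 1
    even for N = 0, as the injectivity of \<open>D\<close> requires.\<close>
  define B where "B = N + 2"
  define D where "D a = B ^ a" for a :: nat
  let ?P = "{(i, j). i < j \<and> j < N}"
  let ?W = "{w. w permutes {..<N}}"
  \<comment> \<open>The highest exponent is sought among partitions with nonzero coefficient only,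
    so the partition that attains it has one.\<close>
  define S where "S = {k\<in>partitions_of N. c k \<noteq> 0}"
  define e where "e k w = (\<Sum>i<N. D (w i) * part k i)" for k w
  define F where "F w i j = (monom 1 (D (w i)) - monom tt (D (w j))) * (monom 1 (D (w j)) - monom 1 (D (w i)))"
    for w :: "nat \<Rightarrow> nat" and i j
  define T where "T w = (\<Prod>(i, j)\<in>?P. F w i j)" for w
  define Q where "Q k w = monom 1 (e k w) * T w" for k w
  define R where "R = (\<Sum>k\<in>partitions_of N. smult (c k / vfac N k) (\<Sum>w\<in>?W. Q k w))"
  \<comment> \<open>The top exponent of every \<open>T w\<close>: each pair contributes twice the
    larger exponent, and w only permutes the pairs.\<close>
  define M where "M = (\<Sum>(i, j)\<in>?P. 2 * max (D i) (D j))"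
  \<comment> \<open>The leading coefficient of (z^a - t z^b) (z^b - z^a) is -1 for a > b and -t for
    a < b; the signs are collected in \<open>\<sigma>\<close>.\<close>
  define \<tau> where "\<tau> w = (\<Prod>(i, j)\<in>?P. if D (w i) < D (w j) then tt else 1)" for w :: "nat \<Rightarrow> nat"
  define \<sigma> :: Qt where "\<sigma> = (\<Prod>(i, j)\<in>?P. - 1)"
  have finW: "finite ?W" by (simp add: finite_permutations)
  have D_inj: "D a = D b \<longleftrightarrow> a = b" for a b
    unfolding D_def by (rule power_inject_exp) (simp add: B_def)
  \<comment> \<open>The relation, taken at the points x_a = z^(B^a), makes every positive power of
    \<open>tt\<close> a root of \<open>R\<close>.\<close>
  have "R = 0"
  proof (rule ccontr)
    assume "R \<noteq> 0"
    then have "finite {z. poly R z = 0}"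
      by (rule poly_roots_finite)
    moreover have "range (\<lambda>k. tt ^ Suc k) \<subseteq> {z. poly R z = 0}"
    proof safe
      fix m :: nat
      define z where "z = tt ^ Suc m"
      define x where "x a = z ^ D a" for a
      have inj: "inj_on x {..<N}"
      proof (rule inj_onI)
        fix a b assume "x a = x b"
        then have "tt ^ (Suc m * D a) = tt ^ (Suc m * D b)"
          unfolding x_def z_def power_mult .
        then have "Suc m * D a = Suc m * D b"
          using power_inject_exp[OF tt_gt_1] by blast
        then have "D a = D b"
          by (metis Suc_mult_cancel1)
        then show "a = b" using D_inj by simp
      qed
      have pQ: "poly (Q k w) z = (\<Prod>i<N. x (w i) ^ part k i)
          * (\<Prod>(i, j)\<in>?P. (x (w i) - tt * x (w j)) * (x (w j) - x (w i)))" for k w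
        unfolding Q_def T_def F_def e_def x_def
        by (simp add: poly_monom power_sum power_mult poly_prod case_prod_unfold)
      have "poly R z = (\<Sum>k\<in>partitions_of N. c k * (1 / vfac N k * (\<Sum>w\<in>?W. poly (Q k w) z)))"
        unfolding R_def by (simp add: poly_sum)
      also have "\<dots> = (\<Sum>k\<in>partitions_of N. c k * HLP N k x) * (\<Prod>(i, j)\<in>?P. (x i - x j) * (x j - x i))"
        unfolding pQ HLP_discriminant[OF inj, symmetric] sum_distrib_right mult.assoc ..
      also have "\<dots> = 0"
        using rel[OF inj] by simp
      finally show "poly R (tt ^ Suc m) = 0"
        unfolding z_def .
    qed
    ultimately show False
      using infinite_range_tt_power finite_subset by blast
  qed
  have top: "degree (Q k w) \<le> e k w + M \<and> coeff (Q k w) (e k w + M) = \<sigma> * \<tau> w" if w: "w \<in> ?W" for k w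
  proof -
    have F: "degree (F w i j) \<le> 2 * max (D (w i)) (D (w j)) \<and>
      coeff (F w i j) (2 * max (D (w i)) (D (w j))) = - 1 * (if D (w i) < D (w j) then tt else 1)"
      if ij: "i < j" for i j
    proof -
      define a b where "a = D (w i)" and "b = D (w j)"
      have "a \<noteq> b"
        using w ij permutes_inj[of w] by (auto simp: a_def b_def D_inj dest: injD)
      let ?p = "monom 1 a - monom tt b" and ?q = "monom 1 b - monom 1 a :: Qt poly"
      have dp: "degree ?p \<le> max a b" and dq: "degree ?q \<le> max a b"
        using degree_diff_le_max[of "monom 1 a" "monom tt b"] degree_diff_le_max[of "monom (1::Qt) b" "monom 1 a"]
          degree_monom_le[of "1::Qt" a] degree_monom_le[of tt b] degree_monom_le[of "1::Qt" b] by linarith+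
      have "degree (?p * ?q) \<le> 2 * max a b"
        using degree_mult_le[of ?p ?q] dp dq by linarith
      moreover have "coeff (?p * ?q) (max a b + max a b) = coeff ?p (max a b) * coeff ?q (max a b)"
        by (rule coeff_mult_sum_bounds[OF dp dq])
      ultimately show ?thesis
        using \<open>a \<noteq> b\<close> unfolding F_def a_def[symmetric] b_def[symmetric] mult_2
        by (auto simp: max_def)
    qed
    have "(\<Sum>(i, j)\<in>?P. 2 * max (D (w i)) (D (w j))) = M"
      unfolding M_def using w by (intro sum_pairs_permute[of "\<lambda>i j. 2 * max (D i) (D j)"]) (auto simp: max.commute)
    moreover have "degree (T w) \<le> (\<Sum>(i, j)\<in>?P. 2 * max (D (w i)) (D (w j)))
      \<and> coeff (T w) (\<Sum>(i, j)\<in>?P. 2 * max (D (w i)) (D (w j)))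
        = (\<Prod>p\<in>?P. coeff (case p of (i, j) \<Rightarrow> F w i j) (case p of (i, j) \<Rightarrow> 2 * max (D (w i)) (D (w j))))"
      unfolding T_def using F by (intro coeff_prod_top) auto
    moreover have "(\<Prod>p\<in>?P. coeff (case p of (i, j) \<Rightarrow> F w i j) (case p of (i, j) \<Rightarrow> 2 * max (D (w i)) (D (w j))))
        = (\<Prod>p\<in>?P. (case p of (i, j) \<Rightarrow> - 1) * (case p of (i, j) \<Rightarrow> if D (w i) < D (w j) then tt else 1))"
      using F by (intro prod.cong) auto
    ultimately have T: "degree (T w) \<le> M" "coeff (T w) M = \<sigma> * \<tau> w"
      by (simp_all only: prod.distrib \<sigma>_def \<tau>_def)
    have "degree (Q k w) \<le> e k w + M"
      using degree_mult_le[of "monom 1 (e k w)" "T w"] degree_monom_le[of "1::Qt" "e k w"] T(1)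
      unfolding Q_def by linarith
    moreover have "coeff (Q k w) (e k w + M) = coeff (monom 1 (e k w)) (e k w) * coeff (T w) M"
      unfolding Q_def by (rule coeff_mult_sum_bounds[OF degree_monom_le T(1)])
    ultimately show ?thesis
      using T(2) by simp
  qed
  \<comment> \<open>The digits of \<open>e k w\<close> are the parts of k in the order given by w,
    so the exponent determines k. It need not determine w, since parts may be equal; hence the sum
    over w in the top coefficient.\<close>
  have e_inj: "k = k'" if k: "k \<in> partitions_of N" "w \<in> ?W" and k': "k' \<in> partitions_of N" "w' \<in> ?W"
    and eq: "e k w = e k' w'" for k k' w w'
  proof -
    have e_alt: "e k w = (\<Sum>a<N. B ^ a * part k (inv w a))" if "w \<in> ?W" for k w
    proof -
      have w: "w permutes {..<N}" using that by simp
      show ?thesis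
        using sum.permute[OF w, of "\<lambda>a. B ^ a * part k (inv w a)"]
        by (simp add: e_def D_def o_def permutes_inverses[OF w])
    qed
    have lt: "part k i < B" if "k \<in> partitions_of N" for k i
      using part_le_psize[of k i] that by (simp add: B_def partitions_of_def)
    have digit: "part k (inv w a) = part k' (inv w' a)" if "a < N" for a
      using eq lt[OF k(1)] lt[OF k'(1)] that unfolding e_alt[OF k(2)] e_alt[OF k'(2)]
      by (rule digits_unique)
    have p: "is_partition k" "length k \<le> N" "is_partition k'" "length k' \<le> N"
      using k k' length_le_psize[of k] length_le_psize[of k'] by (auto simp: partitions_of_def)
    show "k = k'"
    proof (rule partition_eqI_conjp[OF p(1,3)])
      fix j :: nat assume j: "1 \<le> j"
      have "{a\<in>{..<N}. j \<le> part k (inv w a)} = {a\<in>{..<N}. j \<le> part k' (inv w' a)}"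
        using digit by auto
      then show "conjp k j = conjp k' j"
        using conjp_card_permute[OF p(1,2) _ j, of w] conjp_card_permute[OF p(3,4) _ j, of w'] k k' by simp
    qed
  qed
  define E where "E = Max ((\<lambda>(k, w). e k w) ` (S \<times> ?W))"
  have finSW: "finite ((\<lambda>(k, w). e k w) ` (S \<times> ?W))"
    using finW by (simp add: S_def)
  have "id \<in> ?W" by (simp add: permutes_id)
  then have "(k, id) \<in> S \<times> ?W"
    using k \<open>c k \<noteq> 0\<close> by (simp add: S_def)
  then have "(\<lambda>(k, w). e k w) ` (S \<times> ?W) \<noteq> {}" by blast
  then have "E \<in> (\<lambda>(k, w). e k w) ` (S \<times> ?W)"
    unfolding E_def using finSW Max_in by blast
  then obtain k0 w0 where k0: "k0 \<in> S" "w0 \<in> ?W" "e k0 w0 = E" by auto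
  have le: "e k w \<le> E" if "k \<in> S" "w \<in> ?W" for k w
    unfolding E_def by (rule Max_ge[OF finSW]) (use that in auto)
  have coeff_Q: "coeff (Q k w) (E + M) = (if e k w = E then \<sigma> * \<tau> w else 0)" if "k \<in> S" "w \<in> ?W" for k w
  proof (cases "e k w = E")
    case False
    then have "degree (Q k w) < E + M"
      using top[OF that(2), of k] le[OF that] by linarith
    then show ?thesis using False by (simp add: coeff_eq_0)
  qed (use top[OF that(2), of k] in auto)
  have "coeff R (E + M) = (\<Sum>k\<in>partitions_of N. c k / vfac N k * (\<Sum>w\<in>?W. coeff (Q k w) (E + M)))"
    unfolding R_def by (simp add: coeff_sum)
  also have "\<dots> = c k0 / vfac N k0 * (\<Sum>w\<in>?W. coeff (Q k0 w) (E + M))"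
  proof (rule sum.remove[THEN trans])
    show "k0 \<in> partitions_of N" using k0 by (simp add: S_def)
    have "c k / vfac N k * (\<Sum>w\<in>?W. coeff (Q k w) (E + M)) = 0" if "k \<in> partitions_of N - {k0}" for k
    proof (cases "c k = 0")
      case False
      then have kS: "k \<in> S" using that by (simp add: S_def)
      have "coeff (Q k w) (E + M) = 0" if w: "w \<in> ?W" for w
        using coeff_Q[OF kS w] e_inj[of k w k0 w0] w k0 kS \<open>k \<in> partitions_of N - {k0}\<close> by (auto simp: S_def)
      then show ?thesis by simp
    qed simp
    then show "c k0 / vfac N k0 * (\<Sum>w\<in>?W. coeff (Q k0 w) (E + M))
        + (\<Sum>k\<in>partitions_of N - {k0}. c k / vfac N k * (\<Sum>w\<in>?W. coeff (Q k w) (E + M)))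
      = c k0 / vfac N k0 * (\<Sum>w\<in>?W. coeff (Q k0 w) (E + M))"
      using sum.neutral[of "partitions_of N - {k0}"
          "\<lambda>k. c k / vfac N k * (\<Sum>w\<in>?W. coeff (Q k w) (E + M))"] by simp
  qed simp
  also have "(\<Sum>w\<in>?W. coeff (Q k0 w) (E + M)) = (\<Sum>w\<in>{w\<in>?W. e k0 w = E}. \<sigma> * \<tau> w)"
    unfolding sum.inter_filter[OF finW] using coeff_Q[OF k0(1)] by (intro sum.cong) auto
  also have "\<dots> = \<sigma> * (\<Sum>w\<in>{w\<in>?W. e k0 w = E}. \<tau> w)"
    by (rule sum_distrib_left[symmetric])
  finally have "c k0 / vfac N k0 * (\<sigma> * (\<Sum>w\<in>{w\<in>?W. e k0 w = E}. \<tau> w)) = 0"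
    using \<open>R = 0\<close> by simp
  moreover have "c k0 \<noteq> 0" using k0 by (simp add: S_def)
  moreover have "\<sigma> \<noteq> 0" by (auto simp: \<sigma>_def)
  moreover have "0 < (\<Sum>w\<in>{w\<in>?W. e k0 w = E}. \<tau> w)"
  proof (rule sum_pos)
    show "0 < \<tau> w" for w
      unfolding \<tau>_def by (intro prod_pos) (auto simp: tt_pos)
    show "finite {w\<in>?W. e k0 w = E}" using finW by simp
    show "{w\<in>?W. e k0 w = E} \<noteq> {}" using k0 by auto
  qed
  ultimately show False by simp
qed

section \<open>Products of Hall--Littlewood polynomials\<close>

definition HL_span :: "nat \<Rightarrow> nat \<Rightarrow> ((nat \<Rightarrow> Qt) \<Rightarrow> Qt) \<Rightarrow> bool" where
  "HL_span N n f \<longleftrightarrow> (\<exists>c. \<forall>x. inj_on x {..<N} \<longrightarrow> f x = (\<Sum>k\<in>partitions_of n. c k * HLP N k x))"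

lemma HL_span_cong: "(\<And>x. inj_on x {..<N} \<Longrightarrow> f x = g x) \<Longrightarrow> HL_span N n g \<Longrightarrow> HL_span N n f"
  by (simp add: HL_span_def)

lemma HL_span_HLP:
  assumes "k \<in> partitions_of n"
  shows "HL_span N n (HLP N k)"
  unfolding HL_span_def
  using assms by (intro exI[of _ "\<lambda>j. if j = k then 1 else 0"]) (simp add: if_distrib[of "\<lambda>u. u * _"] cong: if_cong)

lemma HL_span_sum:
  assumes "\<And>i. i \<in> A \<Longrightarrow> HL_span N n (f i)"
  shows "HL_span N n (\<lambda>x. \<Sum>i\<in>A. a i * f i x)"
proof -
  obtain c where c: "\<And>i x. i \<in> A \<Longrightarrow> inj_on x {..<N} \<Longrightarrow> f i x = (\<Sum>k\<in>partitions_of n. c i k * HLP N k x)"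
    using assms unfolding HL_span_def by metis
  show ?thesis
    unfolding HL_span_def
  proof (intro exI allI impI)
    fix x :: "nat \<Rightarrow> Qt" assume "inj_on x {..<N}"
    then have "(\<Sum>i\<in>A. a i * f i x) = (\<Sum>i\<in>A. \<Sum>k\<in>partitions_of n. a i * c i k * HLP N k x)"
      by (simp add: c sum_distrib_left mult.assoc)
    also have "\<dots> = (\<Sum>k\<in>partitions_of n. (\<Sum>i\<in>A. a i * c i k) * HLP N k x)"
      by (subst sum.swap) (simp add: sum_distrib_right)
    finally show "(\<Sum>i\<in>A. a i * f i x) = (\<Sum>k\<in>partitions_of n. (\<Sum>i\<in>A. a i * c i k) * HLP N k x)" .
  qed
qed

lemma HL_span_diff:
  assumes "HL_span N n f" "HL_span N n g"
  shows "HL_span N n (\<lambda>x. f x - g x)"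
proof -
  \<comment> \<open>A difference is a linear combination indexed by the two truth values.\<close>
  have "HL_span N n (\<lambda>x. \<Sum>b\<in>UNIV. (if b then 1 else - 1) * (if b then f else g) x)"
    by (rule HL_span_sum) (use assms in auto)
  then show ?thesis
    by (simp add: UNIV_bool)
qed

lemma HL_span_esym:
  assumes f: "HL_span N n f" and N: "n + r \<le> N"
  shows "HL_span N (n + r) (\<lambda>x. esym N x r * f x)"
proof -
  obtain c where c: "\<And>x. inj_on x {..<N} \<Longrightarrow> f x = (\<Sum>k\<in>partitions_of n. c k * HLP N k x)"
    using f unfolding HL_span_def by blast
  have "HL_span N (n + r) (\<lambda>x. \<Sum>k\<in>partitions_of n. c k * (esym N x r * HLP N k x))"
  proof (rule HL_span_sum)
    fix k assume k: "k \<in> partitions_of n"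
    have "HL_span N (n + r) (\<lambda>x. \<Sum>p\<in>{p. p \<in> partitions_of (n + r) \<and> contained k p}. vs p k * HLP N p x)"
      by (rule HL_span_sum) (rule HL_span_HLP, simp)
    then show "HL_span N (n + r) (\<lambda>x. esym N x r * HLP N k x)"
      by (rule HL_span_cong[rotated]) (use k N HLP_Pieri[of k r N] in \<open>auto simp: partitions_of_def\<close>)
  qed
  then show ?thesis
    by (rule HL_span_cong[rotated]) (simp add: c sum_distrib_left mult.left_commute)
qed

section \<open>Removing the first column, and closure of the span under products\<close>

definition strip_col :: "nat list \<Rightarrow> nat list" where
  "strip_col s = filter ((<) 0) (map (\<lambda>x. x - 1) s)"

lemma is_partition_strip_col: "is_partition s \<Longrightarrow> is_partition (strip_col s)"
  unfolding is_partition_def strip_col_def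
  by (auto intro!: sorted_wrt_filter simp: sorted_wrt_map elim!: sorted_wrt_mono_rel[rotated])

lemma conjp_strip_col: "1 \<le> j \<Longrightarrow> conjp (strip_col s) j = conjp s (Suc j)"
  unfolding conjp_def strip_col_def by (induction s) auto

lemma psize_strip_col: "is_partition s \<Longrightarrow> psize (strip_col s) + length s = psize s"
  unfolding is_partition_def psize_def strip_col_def by (induction s) auto

lemma contained_strip_col: "is_partition s \<Longrightarrow> contained (strip_col s) s"
  by (simp add: contained_iff_conjp is_partition_strip_col conjp_strip_col conjp_antimono)

lemma vertical_strip_strip_col: "is_partition s \<Longrightarrow> vertical_strip s (strip_col s)"
  by (simp add: vertical_strip_iff_conjp is_partition_strip_col conjp_strip_col)

lemma vs_strip_col:
  assumes s: "is_partition s"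
  shows "vs s (strip_col s) = 1"
  unfolding vs_conjp[OF s is_partition_strip_col[OF s] contained_strip_col[OF s]
      vertical_strip_strip_col[OF s] order_refl]
  by (rule prod.neutral) (simp add: conjp_strip_col)

text \<open>The strip condition confines column j + 1 of p to column j of
  \<open>strip_col s\<close>, which is column j + 1 of s. The bound on the length confines the first
  column, so p lies inside s, and equal sizes force equality.\<close>

lemma vertical_strip_strip_col_length:
  assumes s: "is_partition s" and p: "is_partition p" and v: "vertical_strip p (strip_col s)"
    and size: "psize p = psize s" and len: "length p \<le> length s"
  shows "p = s"
proof (rule contained_psize_eq[OF p s _ size])
  have "conjp p j \<le> conjp s j" if j: "1 \<le> j" for j
  proof (cases "j = 1")
    case True
    then show ?thesis using len conjp_1[OF p] conjp_1[OF s] by simp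
  next
    case False
    then obtain i where i: "j = Suc i" "1 \<le> i" using j by (cases j) auto
    then have "conjp p (Suc i) \<le> conjp (strip_col s) i"
      using v vertical_strip_iff_conjp[OF is_partition_strip_col[OF s] p] by simp
    then show ?thesis using i by (simp add: conjp_strip_col)
  qed
  then show "contained p s"
    by (simp add: contained_iff_conjp[OF p s])
qed

text \<open>With \<open>r\<close> the length of \<open>s\<close>, the Pieri rule for \<open>strip_col s\<close> and \<open>esym r\<close> expresses
  \<open>HLP s\<close> through Hall--Littlewood polynomials of smaller size or of greater length.\<close>

lemma HL_span_mult:
  assumes "is_partition s" "is_partition m" "psize s + psize m \<le> N"
  shows "HL_span N (psize s + psize m) (\<lambda>x. HLP N s x * HLP N m x)"
  using assms(1,3)
\<comment> \<open>The size decreases first. At equal size the length increases; it is bounded by the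
  size, so the difference decreases.\<close>
proof (induction s rule: wf_induct_rule[OF wf_measures[of "[psize, \<lambda>s. psize s - length s]"]])
  case (1 s)
  note s = 1(2) and sN = 1(3)
  have IH: "HL_span N (psize p + psize m) (\<lambda>x. HLP N p x * HLP N m x)"
    if "is_partition p" "psize p < psize s \<or> psize p = psize s \<and> length s < length p" for p
  proof (rule "1.IH")
    show "(p, s) \<in> measures [psize, \<lambda>s. psize s - length s]"
      using that length_le_psize[OF that(1)] by auto
    show "is_partition p" by (rule that)
    show "psize p + psize m \<le> N" using that sN by auto
  qed
  show ?case
  proof (cases "s = []")
    case True
    have "HL_span N (psize m) (HLP N m)"
      using assms(2) by (intro HL_span_HLP) (simp add: partitions_of_def)
    then have "HL_span N (psize m) (\<lambda>x. HLP N s x * HLP N m x)"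
      by (rule HL_span_cong[rotated]) (simp add: True HLP_Nil)
    then show ?thesis by (simp add: True)
  next
    case False
    define v where "v = strip_col s"
    define r where "r = length s"
    define A where "A = {p. p \<in> partitions_of (psize s) \<and> contained v p \<and> vertical_strip p v} - {s}"
    have v: "is_partition v" and size: "psize v + r = psize s"
      using is_partition_strip_col[OF s] psize_strip_col[OF s] by (auto simp: v_def r_def)
    have finA: "finite A"
      unfolding A_def by (rule finite_subset[of _ "partitions_of (psize s)"]) auto
    have expand: "esym N x r * HLP N v x = HLP N s x + (\<Sum>p\<in>A. vs p v * HLP N p x)"
      if "inj_on x {..<N}" for x
    proof -
      let ?B = "{p. p \<in> partitions_of (psize s) \<and> contained v p}"
      have finB: "finite ?B"
        by (rule finite_subset[of _ "partitions_of (psize s)"]) auto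
      have sB: "s \<in> ?B"
        using s contained_strip_col[OF s] by (simp add: partitions_of_def v_def)
      have "esym N x r * HLP N v x = (\<Sum>p\<in>?B. vs p v * HLP N p x)"
        using HLP_Pieri[OF v _ that, of r] sN by (simp add: size)
      also have "\<dots> = vs s v * HLP N s x + (\<Sum>p\<in>?B - {s}. vs p v * HLP N p x)"
        by (rule sum.remove[OF finB sB])
      also have "(\<Sum>p\<in>?B - {s}. vs p v * HLP N p x) = (\<Sum>p\<in>A. vs p v * HLP N p x)"
        unfolding A_def by (rule sum.mono_neutral_right) (use finB in \<open>auto simp: vs_def\<close>)
      finally show ?thesis
        by (simp add: v_def vs_strip_col[OF s])
    qed
    have "HL_span N (psize s + psize m) (\<lambda>x. HLP N p x * HLP N m x)" if p: "p \<in> A" for p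
    proof -
      have "is_partition p" "psize p = psize s"
        using p by (auto simp: A_def partitions_of_def)
      moreover have "length s < length p"
        using vertical_strip_strip_col_length[OF s, of p] p calculation
        by (cases "length s < length p") (auto simp: A_def v_def)
      ultimately show ?thesis
        using IH[of p] by simp
    qed
    then have "HL_span N (psize s + psize m) (\<lambda>x. \<Sum>p\<in>A. vs p v * (HLP N p x * HLP N m x))"
      by (rule HL_span_sum)
    moreover have "HL_span N (psize s + psize m) (\<lambda>x. esym N x r * (HLP N v x * HLP N m x))"
    proof -
      have "psize v < psize s"
        using size False by (cases s) (auto simp: r_def)
      then have "HL_span N (psize v + psize m) (\<lambda>x. HLP N v x * HLP N m x)"
        using IH v by blast
      then have "HL_span N (psize v + psize m + r) (\<lambda>x. esym N x r * (HLP N v x * HLP N m x))"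
        by (rule HL_span_esym) (use size sN in simp)
      moreover have "psize v + psize m + r = psize s + psize m"
        using size by simp
      ultimately show ?thesis by simp
    qed
    ultimately have "HL_span N (psize s + psize m)
        (\<lambda>x. esym N x r * (HLP N v x * HLP N m x) - (\<Sum>p\<in>A. vs p v * (HLP N p x * HLP N m x)))"
      by (intro HL_span_diff)
    then show ?thesis
    proof (rule HL_span_cong[rotated])
      fix x :: "nat \<Rightarrow> Qt" assume "inj_on x {..<N}"
      from expand[OF this] have "HLP N s x = esym N x r * HLP N v x - (\<Sum>p\<in>A. vs p v * HLP N p x)"
        by simp
      then show "HLP N s x * HLP N m x
          = esym N x r * (HLP N v x * HLP N m x) - (\<Sum>p\<in>A. vs p v * (HLP N p x * HLP N m x))"
        by (simp add: left_diff_distrib sum_distrib_right mult.assoc)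
    qed
  qed
qed

text \<open>The description in \<open>hl_f\<close> is well defined: \<open>HL_span_mult\<close>
  yields existence, linear independence yields uniqueness on the partitions of N, and the clause on
  the support fixes the values elsewhere.\<close>

theorem HLP_mult:
  assumes s: "is_partition s" and m: "is_partition m" and N: "N = psize s + psize m"
    and inj: "inj_on x {..<N}"
  shows "HLP N s x * HLP N m x = (\<Sum>k\<in>partitions_of N. hl_f s m k * HLP N k x)"
proof -
  define Q where "Q c \<longleftrightarrow> (\<forall>k. c k \<noteq> 0 \<longrightarrow> k \<in> partitions_of N) \<and>
    (\<forall>x. inj_on x {..<N} \<longrightarrow> HLP N s x * HLP N m x = (\<Sum>k\<in>partitions_of N. c k * HLP N k x))" for c
  have "\<exists>!c. Q c"
  proof (rule ex_ex1I)
    obtain c where c: "\<And>x. inj_on x {..<N} \<Longrightarrow> HLP N s x * HLP N m x = (\<Sum>k\<in>partitions_of N. c k * HLP N k x)"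
      using HL_span_mult[OF s m, of N] unfolding HL_span_def N by blast
    have "Q (\<lambda>k. if k \<in> partitions_of N then c k else 0)"
      unfolding Q_def using c by (auto cong: sum.cong)
    then show "\<exists>c. Q c"
      by blast
  next
    fix c d assume c: "Q c" and d: "Q d"
    show "c = d"
    proof
      fix k
      show "c k = d k"
      proof (cases "k \<in> partitions_of N")
        case True
        have "c k - d k = 0"
          by (rule HLP_linear_independent[OF _ True, of "\<lambda>k. c k - d k"])
            (use c d in \<open>simp add: Q_def left_diff_distrib sum_subtractf\<close>)
        then show ?thesis by simp
      next
        case False
        then show ?thesis using c d unfolding Q_def by metis
      qed
    qed
  qed
  then have "Q (THE c. Q c)"
    by (rule theI')
  moreover have "hl_f s m k = (THE c. Q c) k" if "k \<in> partitions_of N" for k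
    using that unfolding hl_f_def Q_def N by (simp add: partitions_of_def Let_def)
  moreover define c where "c = (THE c. Q c)"
  ultimately have "Q c" and hl: "\<And>k. k \<in> partitions_of N \<Longrightarrow> hl_f s m k = c k"
    by simp_all
  have "HLP N s x * HLP N m x = (\<Sum>k\<in>partitions_of N. c k * HLP N k x)"
    using \<open>Q c\<close> inj unfolding Q_def by blast
  also have "\<dots> = (\<Sum>k\<in>partitions_of N. hl_f s m k * HLP N k x)"
    by (rule sum.cong) (simp_all add: hl)
  finally show ?thesis .
qed

text \<open>The evaluation at \<open>x\<close> of the product of \<open>P\<^sub>m\<close> with the complete homogeneous function of degree \<open>r\<close>.\<close>

definition sk_sum :: "nat \<Rightarrow> (nat \<Rightarrow> Qt) \<Rightarrow> nat list \<Rightarrow> nat \<Rightarrow> Qt" where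
  "sk_sum N x m r = (\<Sum>n | n \<in> partitions_of (psize m + r) \<and> contained m n. sk n m * HLP N n x)"

text \<open>The Pieri rule expands each product into diagrams p between m and l, and the exponent of
  y is |l| - |p|; collecting the terms of a fixed l gives \<open>skew_poly l m\<close>. At this
  point \<open>sk_sum\<close> is a formal sum; \<open>sk_sum_eq\<close> shows later that it is a
  product.\<close>

lemma skew_poly_generating:
  assumes m: "is_partition m" and N: "psize m + n \<le> N" and inj: "inj_on x {..<N}"
  shows "(\<Sum>i\<le>n. smult (esym N x i * sk_sum N x m (n - i)) ([:0, 1:] ^ i))
    = (\<Sum>l\<in>partitions_of (psize m + n). smult (HLP N l x) (skew_poly l m))"
proof -
  let ?P = "partitions_of (psize m + n)"
  let ?A = "\<lambda>i. {p. p \<in> partitions_of (psize m + (n - i)) \<and> contained m p}"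
  let ?t = "\<lambda>i p l. if contained p l then smult (HLP N l x * (vs l p * sk p m)) ([:0, 1:] ^ i) else 0"
  have "smult (esym N x i * sk_sum N x m (n - i)) ([:0, 1:] ^ i) = (\<Sum>p\<in>?A i. \<Sum>l\<in>?P. ?t i p l)"
    if i: "i \<le> n" for i
  proof -
    have "esym N x i * sk_sum N x m (n - i) = (\<Sum>p\<in>?A i. sk p m * (esym N x i * HLP N p x))"
      by (simp add: sk_sum_def sum_distrib_left mult.left_commute)
    also have "\<dots> = (\<Sum>p\<in>?A i. sk p m * (\<Sum>l\<in>{l\<in>?P. contained p l}. vs l p * HLP N l x))"
    proof (rule sum.cong[OF refl])
      fix p assume "p \<in> ?A i"
      then have p: "is_partition p" "psize p + i = psize m + n"
        using i by (auto simp: partitions_of_def)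
      show "sk p m * (esym N x i * HLP N p x) = sk p m * (\<Sum>l\<in>{l\<in>?P. contained p l}. vs l p * HLP N l x)"
        using HLP_Pieri[OF p(1) _ inj, of i] p(2) N by simp
    qed
    also have "\<dots> = (\<Sum>p\<in>?A i. \<Sum>l\<in>?P. if contained p l then HLP N l x * (vs l p * sk p m) else 0)"
    proof (rule sum.cong[OF refl])
      fix p
      show "sk p m * (\<Sum>l\<in>{l\<in>?P. contained p l}. vs l p * HLP N l x)
          = (\<Sum>l\<in>?P. if contained p l then HLP N l x * (vs l p * sk p m) else 0)"
        unfolding sum.inter_filter[OF finite_partitions_of] sum_distrib_left
        by (intro sum.cong refl) simp
    qed
    finally show ?thesis
      by (simp add: smult_sum if_distrib[of "\<lambda>c. smult c _"] cong: if_cong)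
  qed
  then have "(\<Sum>i\<le>n. smult (esym N x i * sk_sum N x m (n - i)) ([:0, 1:] ^ i))
      = (\<Sum>i\<le>n. \<Sum>p\<in>?A i. \<Sum>l\<in>?P. ?t i p l)"
    by simp
  also have "\<dots> = (\<Sum>i\<le>n. \<Sum>l\<in>?P. \<Sum>p\<in>?A i. ?t i p l)"
    by (intro sum.cong refl sum.swap)
  also have "\<dots> = (\<Sum>l\<in>?P. \<Sum>i\<le>n. \<Sum>p\<in>?A i. ?t i p l)"
    by (rule sum.swap)
  also have "\<dots> = (\<Sum>l\<in>?P. smult (HLP N l x) (skew_poly l m))"
  proof (rule sum.cong[OF refl])
    fix l assume "l \<in> ?P"
    then have l: "is_partition l" "psize l = psize m + n"
      by (auto simp: partitions_of_def)
    let ?S = "{p. is_partition p \<and> contained m p \<and> contained p l}"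
    let ?h = "\<lambda>p. smult (vs l p * sk p m) ([:0, 1:] ^ (psize l - psize p))"
    have finS: "finite ?S"
      by (rule finite_subset[OF _ finite_contained[OF l(1), of "\<lambda>_. True"]]) auto
    have "skew_poly l m = (\<Sum>i\<le>n. \<Sum>p\<in>{p\<in>?S. psize l - psize p = i}. ?h p)"
      unfolding skew_poly_def
      by (rule sum.group[symmetric]) (use finS l contained_psize_le[OF m] in force)+
    also have "\<dots> = (\<Sum>i\<le>n. \<Sum>p\<in>{p\<in>?A i. contained p l}. smult (vs l p * sk p m) ([:0, 1:] ^ i))"
    proof (rule sum.cong[OF refl])
      fix i assume "i \<in> {..n}"
      then have "{p\<in>?S. psize l - psize p = i} = {p\<in>?A i. contained p l}"
        using l contained_psize_le[OF m] contained_psize_le[OF _ l(1)] by (force simp: partitions_of_def)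
      then show "(\<Sum>p\<in>{p\<in>?S. psize l - psize p = i}. ?h p)
          = (\<Sum>p\<in>{p\<in>?A i. contained p l}. smult (vs l p * sk p m) ([:0, 1:] ^ i))"
        by (intro sum.cong) auto
    qed
    also have "\<dots> = (\<Sum>i\<le>n. \<Sum>p\<in>?A i. if contained p l then smult (vs l p * sk p m) ([:0, 1:] ^ i) else 0)"
    proof (rule sum.cong[OF refl])
      fix i
      have "finite (?A i)"
        by (rule finite_subset[of _ "partitions_of (psize m + (n - i))"]) auto
      then show "(\<Sum>p\<in>{p\<in>?A i. contained p l}. smult (vs l p * sk p m) ([:0, 1:] ^ i))
          = (\<Sum>p\<in>?A i. if contained p l then smult (vs l p * sk p m) ([:0, 1:] ^ i) else 0)"
        by (rule sum.inter_filter)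
    qed
    finally show "(\<Sum>i\<le>n. \<Sum>p\<in>?A i. ?t i p l) = smult (HLP N l x) (skew_poly l m)"
      by (auto simp: smult_sum_right intro!: sum.cong)
  qed
  finally show ?thesis .
qed

text \<open>The generating identity at y = -1, where only l = m survives. For m = [] it is the
  relation between elementary and complete symmetric functions, which identifies
  \<open>sk_sum N x [] r\<close> with h_r.\<close>

lemma sk_sum_recursion:
  assumes m: "is_partition m" and N: "psize m + n \<le> N" and inj: "inj_on x {..<N}"
  shows "(\<Sum>i\<le>n. (- 1) ^ i * esym N x i * sk_sum N x m (n - i)) = (if n = 0 then HLP N m x else 0)"
proof -
  let ?P = "partitions_of (psize m + n)"
  have "(\<Sum>i\<le>n. (- 1) ^ i * esym N x i * sk_sum N x m (n - i))
      = poly (\<Sum>i\<le>n. smult (esym N x i * sk_sum N x m (n - i)) ([:0, 1:] ^ i)) (- 1)"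
    by (simp add: poly_sum mult_ac)
  also have "\<dots> = (\<Sum>l\<in>?P. HLP N l x * poly (skew_poly l m) (- 1))"
    unfolding skew_poly_generating[OF assms] by (simp add: poly_sum)
  also have "\<dots> = (\<Sum>l\<in>?P. if l = m then HLP N m x else 0)"
  proof (rule sum.cong[OF refl])
    fix l assume "l \<in> ?P"
    then have l: "is_partition l" by (simp add: partitions_of_def)
    consider "l = m" | "l \<noteq> m" "contained m l" | "\<not> contained m l" by blast
    then show "HLP N l x * poly (skew_poly l m) (- 1) = (if l = m then HLP N m x else 0)"
    proof cases
      case 1
      then show ?thesis using m by (simp add: skew_poly_refl)
    next
      case 2
      then show ?thesis using poly_skew_poly_minus_1[OF l m] by auto
    next
      case 3
      then have "{p. is_partition p \<and> contained m p \<and> contained p l} = {}"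
        using contained_trans by blast
      then have "skew_poly l m = 0"
        unfolding skew_poly_def by (simp only: sum.empty)
      then show ?thesis using 3 by auto
    qed
  qed
  also have "\<dots> = (if n = 0 then HLP N m x else 0)"
  proof -
    have "m \<in> ?P \<longleftrightarrow> n = 0"
      using m by (simp add: partitions_of_def)
    then show ?thesis
      by simp
  qed
  finally show ?thesis .
qed

text \<open>The Pieri rule for h_n. Since \<open>esym N x 0\<close> is 1, the recursion determines
  \<open>sk_sum N x m\<close> from the start value \<open>HLP N m x\<close>, and the solution is
  proportional to that value.\<close>

lemma sk_sum_eq:
  assumes m: "is_partition m" and N: "psize m + n \<le> N" and inj: "inj_on x {..<N}"
  shows "sk_sum N x m n = sk_sum N x [] n * HLP N m x"
  using N
proof (induction n rule: less_induct)
  case (less n)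
  have rec: "sk_sum N x k n = (if n = 0 then HLP N k x else 0)
      - (\<Sum>i\<in>{..n} - {0}. (- 1) ^ i * esym N x i * sk_sum N x k (n - i))"
    if "is_partition k" "psize k + n \<le> N" for k
  proof -
    have "(\<Sum>i\<le>n. (- 1) ^ i * esym N x i * sk_sum N x k (n - i))
        = (- 1) ^ 0 * esym N x 0 * sk_sum N x k (n - 0)
          + (\<Sum>i\<in>{..n} - {0}. (- 1) ^ i * esym N x i * sk_sum N x k (n - i))"
      by (rule sum.remove) auto
    then show ?thesis
      unfolding sk_sum_recursion[OF that inj] by simp
  qed
  have "(\<Sum>i\<in>{..n} - {0}. (- 1) ^ i * esym N x i * sk_sum N x m (n - i))
      = (\<Sum>i\<in>{..n} - {0}. (- 1) ^ i * esym N x i * sk_sum N x [] (n - i)) * HLP N m x"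
    unfolding sum_distrib_right
  proof (rule sum.cong[OF refl])
    fix i assume "i \<in> {..n} - {0}"
    then show "(- 1) ^ i * esym N x i * sk_sum N x m (n - i) = (- 1) ^ i * esym N x i * sk_sum N x [] (n - i) * HLP N m x"
      using less.IH[of "n - i"] less.prems by simp
  qed
  moreover have "psize [] + n \<le> N" using less.prems by simp
  ultimately show ?case
    using rec[OF m less.prems] rec[of "[]"] HLP_Nil[OF inj] by (simp add: left_diff_distrib)
qed

section \<open>The identity\<close>

theorem theorem7:
  fixes m l :: "nat list"
  assumes "is_partition m" and "is_partition l" and "contained m l"
  shows "(\<Sum>n\<in>{n. is_partition n \<and> contained m n \<and> contained n l}.
            smult (vs l n * sk n m) ([:0, 1:] ^ (psize l - psize n)))
       = (\<Sum>s\<in>{s. is_partition s \<and> psize s + psize m = psize l}.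
            smult (tt powi (int (nfun s) - int (length s choose 2)) * hl_f s m l)
                  (\<Prod>j\<in>{1..length s}. [:tt ^ (j - 1), 1:]))"
proof -
  define N n where "N = psize l" and "n = psize l - psize m"
  have size: "psize m + n = N"
    using contained_psize_le[OF assms] by (simp add: N_def n_def)
  \<comment> \<open>Linear independence needs a relation among all partitions of N, so the
    difference of the two sides is formed for every k and not just for l.\<close>
  define D where "D k = skew_poly k m - (\<Sum>s\<in>partitions_of n. smult (hl_f s m k) (skew_poly s []))" for k
  have rel: "(\<Sum>k\<in>partitions_of N. smult (HLP N k x) (D k)) = 0" if inj: "inj_on x {..<N}" for x
  proof -
    have "(\<Sum>k\<in>partitions_of N. smult (HLP N k x) (skew_poly k m))
        = (\<Sum>i\<le>n. smult (esym N x i * sk_sum N x m (n - i)) ([:0, 1:] ^ i))"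
      using skew_poly_generating[OF assms(1) _ inj, of n] size by simp
    also have "\<dots> = smult (HLP N m x) (\<Sum>i\<le>n. smult (esym N x i * sk_sum N x [] (n - i)) ([:0, 1:] ^ i))"
      unfolding smult_sum_right
    proof (rule sum.cong[OF refl])
      fix i assume "i \<in> {..n}"
      then have "sk_sum N x m (n - i) = sk_sum N x [] (n - i) * HLP N m x"
        using size by (intro sk_sum_eq[OF assms(1) _ inj]) auto
      then show "smult (esym N x i * sk_sum N x m (n - i)) ([:0, 1:] ^ i)
          = smult (HLP N m x) (smult (esym N x i * sk_sum N x [] (n - i)) ([:0, 1:] ^ i))"
        by (simp add: mult_ac)
    qed
    also have "(\<Sum>i\<le>n. smult (esym N x i * sk_sum N x [] (n - i)) ([:0, 1:] ^ i))
        = (\<Sum>s\<in>partitions_of n. smult (HLP N s x) (skew_poly s []))"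
      using skew_poly_generating[OF is_partition_Nil _ inj, of n] size by simp
    also have "smult (HLP N m x) \<dots> = (\<Sum>s\<in>partitions_of n. smult (HLP N s x * HLP N m x) (skew_poly s []))"
      by (simp add: smult_sum_right mult.commute)
    also have "\<dots> = (\<Sum>s\<in>partitions_of n. \<Sum>k\<in>partitions_of N. smult (HLP N k x) (smult (hl_f s m k) (skew_poly s [])))"
    proof (rule sum.cong[OF refl])
      fix s assume "s \<in> partitions_of n"
      then have s: "is_partition s" "N = psize s + psize m"
        using size by (auto simp: partitions_of_def)
      show "smult (HLP N s x * HLP N m x) (skew_poly s [])
          = (\<Sum>k\<in>partitions_of N. smult (HLP N k x) (smult (hl_f s m k) (skew_poly s [])))"
        unfolding HLP_mult[OF s(1) assms(1) s(2) inj] smult_sum by (simp add: mult.commute)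
    qed
    also have "\<dots> = (\<Sum>k\<in>partitions_of N. smult (HLP N k x) (\<Sum>s\<in>partitions_of n. smult (hl_f s m k) (skew_poly s [])))"
      by (subst sum.swap) (simp only: smult_sum_right)
    finally show ?thesis
      by (simp add: D_def smult_diff_right sum_subtractf)
  qed
  have "D l = 0"
  \<comment> \<open>Linear independence concerns coefficients in \<open>Qt\<close>, so it is applied
    to each power of y.\<close>
  proof (rule poly_eqI)
    fix i
    have "coeff (D l) i = 0"
    proof (rule HLP_linear_independent[of N "\<lambda>k. coeff (D k) i"])
      show "l \<in> partitions_of N"
        using assms(2) by (simp add: partitions_of_def N_def)
      fix x :: "nat \<Rightarrow> Qt" assume "inj_on x {..<N}"
      from arg_cong[OF rel[OF this], of "\<lambda>p. coeff p i"]
      show "(\<Sum>k\<in>partitions_of N. coeff (D k) i * HLP N k x) = 0"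
        by (simp add: coeff_sum mult.commute)
    qed
    then show "coeff (D l) i = coeff 0 i" by simp
  qed
  then have "skew_poly l m = (\<Sum>s\<in>partitions_of n. smult (hl_f s m l) (skew_poly s []))"
    by (simp add: D_def)
  also have "\<dots> = (\<Sum>s\<in>partitions_of n. smult (tt powi (int (nfun s) - int (length s choose 2)) * hl_f s m l)
                  (\<Prod>j\<in>{1..length s}. [:tt ^ (j - 1), 1:]))"
    by (intro sum.cong refl) (simp add: skew_poly_Nil partitions_of_def mult.commute)
  also have "partitions_of n = {s. is_partition s \<and> psize s + psize m = psize l}"
    using size by (auto simp: partitions_of_def N_def)
  finally show ?thesis
    unfolding skew_poly_def .
qed

end
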